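(* Let $m\geq 74$ be even and let $G$ be a $C_{5}^{+}$-free graph with $m$ edges and no isolated vertices. Then $\rho(G)\leq \rho(S_{\frac{m+4}{2},2}^{-})$, and equality holds if and only if $G\cong S_{\frac{m+4}{2},2}^{-}$.
   Context: All graphs are finite, simple and undirected; $\rho(G)$ is the spectral radius of the adjacency matrix of $G$. A graph is $F$-free if it contains no subgraph isomorphic to $F$. $C_{t}^{+}$ denotes the graph obtained from the cycle $C_{t}$ and a triangle $C_{3}$ by identifying an edge of each; so $C_5^+$ is a $5$-cycle together with one extra vertex adjacent to both endpoints of one edge of the cycle. $S_{n,k}$ denotes the graph obtained by joining each vertex of a complete graph $K_{k}$ to each of $n-k$ isolated vertices, and $S_{n,k}^{-}$ denotes the graph obtained from $S_{n,k}$ by deleting an edge incident to a vertex of degree two. (Thus $S_{\frac{m+4}{2},2}^{-}$ has $m$ edges.) *)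

theory Defs
  imports "Jordan_Normal_Form.Spectral_Radius"
begin

record 'a graph =
  verts :: "'a set"
  edges :: "'a set set"

definition simple_graph :: "'a graph \<Rightarrow> bool" where
  "simple_graph G \<longleftrightarrow>
     finite (verts G) \<and> edges G \<subseteq> {{u, v} | u v. u \<in> verts G \<and> v \<in> verts G \<and> u \<noteq> v}"

definition subgraph :: "'a graph \<Rightarrow> 'a graph \<Rightarrow> bool" where
  "subgraph H G \<longleftrightarrow> simple_graph H \<and> verts H \<subseteq> verts G \<and> edges H \<subseteq> edges G"

definition graph_iso :: "'a graph \<Rightarrow> 'b graph \<Rightarrow> bool" (infix \<open>\<cong>\<^sub>g\<close> 50) where
  "G \<cong>\<^sub>g H \<longleftrightarrow>
     (\<exists>f. bij_betw f (verts G) (verts H) \<and>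
          (\<forall>u \<in> verts G. \<forall>v \<in> verts G. {u, v} \<in> edges G \<longleftrightarrow> {f u, f v} \<in> edges H))"

definition graph_free :: "'b graph \<Rightarrow> 'a graph \<Rightarrow> bool" where
  "graph_free F G \<longleftrightarrow> \<not> (\<exists>H. subgraph H G \<and> H \<cong>\<^sub>g F)"

definition vertex_degree :: "'a graph \<Rightarrow> 'a \<Rightarrow> nat" where
  "vertex_degree G v = card {e \<in> edges G. v \<in> e}"

definition isolated_vertex :: "'a graph \<Rightarrow> 'a \<Rightarrow> bool" where
  "isolated_vertex G v \<longleftrightarrow> v \<in> verts G \<and> vertex_degree G v = 0"

text \<open>The adjacency matrix with respect to an enumeration \<open>xs\<close> of the vertices. Its entries are
  complex because the spectral radius is only defined for complex matrices.\<close>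

definition adjacency_matrix :: "'a graph \<Rightarrow> 'a list \<Rightarrow> complex mat" where
  "adjacency_matrix G xs =
     mat (length xs) (length xs) (\<lambda>(i, j). if {xs ! i, xs ! j} \<in> edges G then 1 else 0)"

definition enumerates :: "'a list \<Rightarrow> 'a graph \<Rightarrow> bool" where
  "enumerates xs G \<longleftrightarrow> distinct xs \<and> set xs = verts G"

text \<open>The choice of the enumeration is irrelevant, see \<open>graph_spectral_radius_eq\<close> below.\<close>

definition graph_spectral_radius :: "'a graph \<Rightarrow> real" (\<open>\<rho>\<close>) where
  "\<rho> G = spectral_radius (adjacency_matrix G (SOME xs. enumerates xs G))"

text \<open>\<open>C\<^sub>t\<^sup>+\<close> for \<open>t \<ge> 3\<close>: the cycle on \<open>0, \<dots>, t - 1\<close> and the triangle on \<open>0, 1, t\<close> share the edge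
  \<open>{0, 1}\<close>.\<close>

definition cycle_plus :: "nat \<Rightarrow> nat graph" where
  "cycle_plus t =
     \<lparr>verts = {..t}, edges = {{i, (i + 1) mod t} | i. i < t} \<union> {{0, t}, {1, t}}\<rparr>"

text \<open>\<open>S\<^sub>n\<^sub>,\<^sub>k\<close>: the vertices \<open>0, \<dots>, k - 1\<close> form the complete graph, the vertices \<open>k, \<dots>, n - 1\<close> are
  independent.\<close>

definition S_graph :: "nat \<Rightarrow> nat \<Rightarrow> nat graph" where
  "S_graph n k = \<lparr>verts = {..<n}, edges = {{u, v} | u v. u < k \<and> u < n \<and> v < n \<and> u \<noteq> v}\<rparr>"

text \<open>The deleted edge is incident to the vertex \<open>n - 1\<close>, which lies outside the complete graph
  and has degree \<open>k\<close>. Hence it has degree two, as required, precisely when \<open>k = 2\<close>; in this case all edges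
  incident to a vertex of degree two are equivalent under automorphisms.\<close>

definition S_minus :: "nat \<Rightarrow> nat \<Rightarrow> nat graph" where
  "S_minus n k = (S_graph n k)\<lparr>edges := edges (S_graph n k) - {{0, n - 1}}\<rparr>"

lemma eigenvalue_adjacency_matrix_reorder:
  assumes "enumerates xs G" "enumerates ys G"
    and "eigenvalue (adjacency_matrix G xs) c"
  shows "eigenvalue (adjacency_matrix G ys) c"
proof -
  define n where "n = length xs"
  have n: "length ys = n"
    using assms(1,2) distinct_card unfolding enumerates_def n_def by metis
  have bx: "bij_betw ((!) xs) {..<n} (verts G)" and bY: "bij_betw ((!) ys) {..<n} (verts G)"
    using assms(1,2) n unfolding enumerates_def n_def by (auto intro: bij_betw_nth)
  define p where "p = the_inv_into {..<n} ((!) xs) \<circ> (!) ys"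
  have bp: "bij_betw p {..<n} {..<n}"
    unfolding p_def by (rule bij_betw_trans[OF bY bij_betw_the_inv_into[OF bx]])
  have px: "xs ! p i = ys ! i" if "i < n" for i
    using that bx bY unfolding p_def by (auto simp: bij_betw_def intro!: f_the_inv_into_f)
  have pn: "p i < n" if "i < n" for i using bp that by (auto simp: bij_betw_def)
  let ?A = "adjacency_matrix G xs" and ?B = "adjacency_matrix G ys"
  have dims: "dim_row ?A = n" "dim_col ?A = n" "dim_row ?B = n" "dim_col ?B = n"
    by (auto simp: adjacency_matrix_def n n_def)
  obtain v where v: "v \<in> carrier_vec n" "v \<noteq> 0\<^sub>v n" "?A *\<^sub>v v = c \<cdot>\<^sub>v v"
    using assms(3) unfolding eigenvalue_def eigenvector_def dims by auto
  define w where "w = vec n (\<lambda>i. v $ p i)"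
  have Av: "(\<Sum>j<n. ?A $$ (i, j) * v $ j) = c * v $ i" if "i < n" for i
  proof -
    have "(?A *\<^sub>v v) $ i = (\<Sum>j<n. ?A $$ (i, j) * v $ j)"
      using that v(1) dims by (auto simp: scalar_prod_def atLeast0LessThan intro!: sum.cong)
    then show ?thesis using v that by simp
  qed
  have "w \<noteq> 0\<^sub>v n"
  proof
    assume w0: "w = 0\<^sub>v n"
    have "v $ j = 0" if "j < n" for j
    proof -
      from bp that obtain i where i: "i < n" "j = p i" by (auto simp: bij_betw_def)
      have "w $ i = 0" using w0 i by simp
      then show ?thesis using i by (simp add: w_def)
    qed
    then show False using v(1,2) by auto
  qed
  moreover have "?B *\<^sub>v w = c \<cdot>\<^sub>v w"
  proof (rule eq_vecI)
    fix i assume "i < dim_vec (c \<cdot>\<^sub>v w)"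
    then have i: "i < n" by (simp add: w_def)
    have "(?B *\<^sub>v w) $ i = (\<Sum>j<n. ?B $$ (i, j) * w $ j)"
      using i dims by (auto simp: scalar_prod_def atLeast0LessThan w_def intro!: sum.cong)
    also have "\<dots> = (\<Sum>j<n. ?A $$ (p i, p j) * v $ p j)"
      using i n pn px by (intro sum.cong) (auto simp: adjacency_matrix_def w_def n_def[symmetric])
    also have "\<dots> = (\<Sum>j<n. ?A $$ (p i, j) * v $ j)"
      using sum.reindex_bij_betw[OF bp, of "\<lambda>j. ?A $$ (p i, j) * v $ j"] .
    also have "\<dots> = c * v $ p i" using Av pn i by blast
    finally show "(?B *\<^sub>v w) $ i = (c \<cdot>\<^sub>v w) $ i" using i by (simp add: w_def)
  qed (simp add: dims w_def)
  ultimately show ?thesis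
    unfolding eigenvalue_def eigenvector_def dims by (intro exI[of _ w]) (simp add: w_def)
qed

lemma graph_spectral_radius_eq:
  assumes "enumerates xs G"
  shows "\<rho> G = spectral_radius (adjacency_matrix G xs)"
proof -
  have e: "enumerates (SOME xs. enumerates xs G) G" using assms by (rule someI)
  have "spectrum (adjacency_matrix G (SOME xs. enumerates xs G)) = spectrum (adjacency_matrix G xs)"
    unfolding spectrum_def
    using eigenvalue_adjacency_matrix_reorder[OF e assms]
      eigenvalue_adjacency_matrix_reorder[OF assms e] by auto
  then show ?thesis unfolding graph_spectral_radius_def spectral_radius_def by simp
qed

lemma simple_graph_cycle_plus:
  assumes "t \<ge> 2"
  shows "simple_graph (cycle_plus t)"
proof -
  have "\<exists>u v. {i, (i + 1) mod t} = {u, v} \<and> u \<le> t \<and> v \<le> t \<and> u \<noteq> v" if "i < t" for i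
  proof -
    have "(i + 1) mod t \<le> t" "i \<noteq> (i + 1) mod t"
      using assms that by (auto simp: less_imp_le mod_Suc)
    then show ?thesis using that by (intro exI[of _ i] exI[of _ "(i + 1) mod t"]) simp
  qed
  moreover have "\<exists>u v. {0, t} = {u, v} \<and> u \<le> t \<and> v \<le> t \<and> u \<noteq> v"
    using assms by (intro exI[of _ 0] exI[of _ t]) auto
  moreover have "\<exists>u v. {1, t} = {u, v} \<and> u \<le> t \<and> v \<le> t \<and> u \<noteq> v"
    using assms by (intro exI[of _ 1] exI[of _ t]) auto
  ultimately show ?thesis
    unfolding simple_graph_def cycle_plus_def by auto
qed

lemma simple_graph_S_graph: "simple_graph (S_graph n k)"
  by (auto simp: simple_graph_def S_graph_def)

lemma simple_graph_S_minus: "simple_graph (S_minus n k)"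
  by (auto simp: simple_graph_def S_graph_def S_minus_def)

lemma vertex_degree_S_graph:
  assumes "k \<le> v" "v < n"
  shows "vertex_degree (S_graph n k) v = k"
proof -
  have "{e \<in> edges (S_graph n k). v \<in> e} = (\<lambda>u. {u, v}) ` {..<k}"
  proof (intro equalityI subsetI)
    fix e assume "e \<in> (\<lambda>u. {u, v}) ` {..<k}"
    then obtain u where "e = {u, v}" "u < k" by auto
    moreover from this have "u < n" "u \<noteq> v" using assms by auto
    ultimately show "e \<in> {e \<in> edges (S_graph n k). v \<in> e}" using assms(2)
      unfolding S_graph_def by simp blast
  qed (use assms in \<open>auto simp: S_graph_def\<close>)
  moreover have "inj_on (\<lambda>u. {u, v}) {..<k}"
    using assms by (auto simp: inj_on_def doubleton_eq_iff)
  ultimately show ?thesis by (simp add: vertex_degree_def card_image)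
qed

lemma card_edges_S_minus:
  assumes "even m" "m \<ge> 2"
  shows "card (edges (S_minus ((m + 4) div 2) 2)) = m"
proof -
  define n where "n = (m + 4) div 2"
  have n: "n \<ge> 3" "m = 2 * n - 4" using assms by (auto simp: n_def)
  have "edges (S_graph n 2) = {{0, 1}} \<union> (\<lambda>v. {0, v}) ` {2..<n} \<union> (\<lambda>v. {1, v}) ` {2..<n}"
    (is "?E = ?A \<union> ?B \<union> ?C")
  proof
    show "?E \<subseteq> ?A \<union> ?B \<union> ?C"
    proof
      fix e assume "e \<in> ?E"
      then obtain u v where uv: "e = {u, v}" "u < 2" "v < n" "u \<noteq> v" by (auto simp: S_graph_def)
      then have "u = 0 \<or> u = 1" "v = 0 \<or> v = 1 \<or> v \<in> {2..<n}" by auto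
      with uv show "e \<in> ?A \<union> ?B \<union> ?C" by auto
    qed
    show "?A \<union> ?B \<union> ?C \<subseteq> ?E"
      using n by (fastforce simp: S_graph_def)
  qed
  moreover have "card (?A \<union> ?B \<union> ?C) = 1 + (n - 2) + (n - 2)"
  proof -
    have card: "card ?B = n - 2" "card ?C = n - 2"
      by (auto simp: card_image inj_on_def doubleton_eq_iff)
    have disj: "X \<inter> Y = {}" if "\<forall>e \<in> X. a \<in> e" "\<forall>e \<in> Y. a \<notin> e" for X Y and a :: nat
      using that by blast
    have fin: "finite ?A" "finite ?B" "finite ?C" by simp_all
    have "card (?A \<union> ?B) = card ?A + card ?B"
      by (intro card_Un_disjoint fin disj[of _ 1]) auto
    moreover have "card (?A \<union> ?B \<union> ?C) = card (?A \<union> ?B) + card ?C"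
      by (intro card_Un_disjoint fin finite_UnI disj[of _ 0]) auto
    moreover have "card ?A = 1" by simp
    ultimately show ?thesis using card by (simp only:)
  qed
  moreover have "{0, n - 1} \<in> ?E"
    using n by (simp add: S_graph_def) (intro exI[of _ 0] exI[of _ "n - 1"], simp)
  ultimately have "card (?E - {{0, n - 1}}) = 1 + (n - 2) + (n - 2) - 1"
    by (simp only: card_Diff_singleton)
  also have "\<dots> = m" using n by simp
  finally show ?thesis by (simp add: S_minus_def n_def)
qed

end

theory Submission
  imports Defs
begin

text \<open>
  Let \<open>r = \<rho> G\<close> be at least the spectral radius of the extremal graph, so \<open>r\<^sup>2 - r > m - 3 / 2\<close>. Let
  \<open>x\<close> be the entrywise modulus of an eigenvector for an eigenvalue of modulus \<open>r\<close>, scaled to have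
  maximum \<open>x u = 1\<close>; then \<open>r * x v\<close> is at most the sum of \<open>x\<close> over the neighbours of \<open>v\<close>. Let \<open>N\<close> be
  the neighbourhood of \<open>u\<close> and \<open>W\<close> the set of the remaining vertices. Applying the
  inequality twice at \<open>u\<close> and subtracting the edge count of \<open>G\<close>, one finds that the sum over the components \<open>H\<close> of
  \<open>G[N]\<close> of \<open>\<Sum>v\<in>H. (deg\<^sub>H v - 1) * x v\<close> minus the number of edges of \<open>H\<close>, minus a penalty for the edges that meet
  \<open>W\<close>, exceeds \<open>- 3 / 2\<close>.

  Since \<open>G\<close> contains no \<open>C\<^sub>5\<^sup>+\<close>, \<open>G[N]\<close> contains no path on five vertices. Its components are therefore
  isolated vertices, stars, double stars, triangles with pendant vertices at one corner, or graphs on four vertices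
  with a spanning 4-cycle. The last two contribute at most \<open>- 3 / 2\<close>: either \<open>x\<close> is small on them, or
  they have many neighbours in \<open>W\<close>, which are costly. A star or double star contributes at most \<open>- 1\<close>,
  so there is exactly one of these. The remaining slack \<open>1 / 2\<close> forces \<open>W\<close> to be empty and leaves only a star
  and, by parity, exactly one isolated vertex.
\<close>

section \<open>Spectral radius and subinvariant vectors\<close>

lemma ex_enumerates: "simple_graph G \<Longrightarrow> \<exists>xs. enumerates xs G"
  using finite_distinct_list[of "verts G"] by (auto simp: simple_graph_def enumerates_def)

text \<open>Carrying an enumeration of \<open>G\<close> along the isomorphism gives literally the
  same adjacency matrix.\<close>

lemma graph_iso_spectral_radius:
  assumes "G \<cong>\<^sub>g H" "simple_graph G"
  shows "\<rho> G = \<rho> H"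
proof -
  obtain f where f: "bij_betw f (verts G) (verts H)"
    "\<And>u v. u \<in> verts G \<Longrightarrow> v \<in> verts G \<Longrightarrow> {u, v} \<in> edges G \<longleftrightarrow> {f u, f v} \<in> edges H"
    using assms(1) unfolding graph_iso_def by blast
  obtain xs where xs: "enumerates xs G" using ex_enumerates[OF assms(2)] by blast
  have "enumerates (map f xs) H"
    using xs f(1) by (auto simp: enumerates_def distinct_map bij_betw_def)
  moreover have "adjacency_matrix G xs = adjacency_matrix H (map f xs)"
  proof (rule eq_matI)
    fix i j assume "i < dim_row (adjacency_matrix H (map f xs))" "j < dim_col (adjacency_matrix H (map f xs))"
    then have ij: "i < length xs" "j < length xs" by (auto simp: adjacency_matrix_def)
    then have "xs ! i \<in> verts G" "xs ! j \<in> verts G"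
      using xs nth_mem[of _ xs] unfolding enumerates_def by blast+
    then show "adjacency_matrix G xs $$ (i, j) = adjacency_matrix H (map f xs) $$ (i, j)"
      using ij f(2) by (simp add: adjacency_matrix_def)
  qed (auto simp: adjacency_matrix_def)
  ultimately show ?thesis using xs by (simp add: graph_spectral_radius_eq)
qed

lemma adjacency_matrix_mult_index:
  assumes "distinct xs" "i < length xs" "dim_vec v = length xs"
  shows "(adjacency_matrix G xs *\<^sub>v v) $ i = (\<Sum>j | j < length xs \<and> {xs ! i, xs ! j} \<in> edges G. v $ j)"
proof -
  have "(adjacency_matrix G xs *\<^sub>v v) $ i =
      (\<Sum>j<length xs. if {xs ! i, xs ! j} \<in> edges G then v $ j else 0)"
    using assms by (auto simp: adjacency_matrix_def scalar_prod_def atLeast0LessThan intro!: sum.cong)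
  also have "\<dots> = (\<Sum>j | j \<in> {..<length xs} \<and> {xs ! i, xs ! j} \<in> edges G. v $ j)"
    by (rule sum.inter_filter[symmetric]) simp
  finally show ?thesis by simp
qed

lemma sum_enumerates:
  assumes "enumerates xs G"
  shows "(\<Sum>j | j < length xs \<and> P (xs ! j). f (xs ! j)) = (\<Sum>w | w \<in> verts G \<and> P w. f w)"
proof -
  have b: "bij_betw ((!) xs) {..<length xs} (verts G)"
    using assms by (auto simp: enumerates_def intro: bij_betw_nth)
  have "bij_betw ((!) xs) {j. j < length xs \<and> P (xs ! j)} {w \<in> verts G. P w}"
    using b unfolding bij_betw_def by (auto intro: inj_on_subset simp: image_iff)
  then show ?thesis by (rule sum.reindex_bij_betw)
qed

text \<open>The nonzero real vector makes \<open>c\<close> an eigenvalue of the complex matrix, so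
  even the modulus of \<open>c\<close> is at most the spectral radius.\<close>

lemma spectral_radius_ge_eigenvalue:
  fixes x :: "'a \<Rightarrow> real"
  assumes G: "simple_graph G" "u \<in> verts G" "x u \<noteq> 0"
    and eig: "\<And>v. v \<in> verts G \<Longrightarrow> (\<Sum>w | w \<in> verts G \<and> {v, w} \<in> edges G. x w) = c * x v"
  shows "c \<le> \<rho> G"
proof -
  obtain xs where xs: "enumerates xs G" using ex_enumerates[OF G(1)] by blast
  define n where "n = length xs"
  let ?A = "adjacency_matrix G xs"
  have A: "?A \<in> carrier_mat n n" by (simp add: adjacency_matrix_def n_def)
  define y where "y = vec n (\<lambda>i. complex_of_real (x (xs ! i)))"
  obtain i where i: "i < n" "xs ! i = u"
    using xs G(2) unfolding enumerates_def n_def by (metis in_set_conv_nth)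
  have "y \<noteq> 0\<^sub>v n"
  proof
    assume "y = 0\<^sub>v n"
    then have "y $ i = 0" using i by simp
    then show False using i G(3) by (simp add: y_def)
  qed
  moreover have "?A *\<^sub>v y = complex_of_real c \<cdot>\<^sub>v y"
  proof (rule eq_vecI)
    fix i assume "i < dim_vec (complex_of_real c \<cdot>\<^sub>v y)"
    then have i: "i < n" by (simp add: y_def)
    then have v: "xs ! i \<in> verts G" using xs nth_mem[of i xs] unfolding enumerates_def n_def by blast
    have "(?A *\<^sub>v y) $ i = (\<Sum>j | j < n \<and> {xs ! i, xs ! j} \<in> edges G. y $ j)"
      using adjacency_matrix_mult_index[of xs i y G] xs i by (simp add: enumerates_def n_def y_def)
    also have "\<dots> = (\<Sum>j | j < n \<and> {xs ! i, xs ! j} \<in> edges G. complex_of_real (x (xs ! j)))"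
      by (intro sum.cong) (auto simp: y_def)
    also have "\<dots> = (\<Sum>w | w \<in> verts G \<and> {xs ! i, w} \<in> edges G. complex_of_real (x w))"
      unfolding n_def by (rule sum_enumerates[OF xs])
    also have "\<dots> = complex_of_real (c * x (xs ! i))" using eig[OF v] by (simp flip: of_real_sum)
    finally show "(?A *\<^sub>v y) $ i = (complex_of_real c \<cdot>\<^sub>v y) $ i" using i by (simp add: y_def)
  qed (simp add: adjacency_matrix_def y_def n_def)
  ultimately have "eigenvalue ?A (complex_of_real c)"
    unfolding eigenvalue_def eigenvector_def using A by (intro exI[of _ y]) (auto simp: y_def)
  then have "norm (complex_of_real c) \<in> norm ` spectrum ?A"
    unfolding spectrum_def by blast
  then have "norm (complex_of_real c) \<le> spectral_radius ?A"
    using spectral_radius_mem_max(2)[OF A] i by auto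
  then show ?thesis using graph_spectral_radius_eq[OF xs] by simp
qed

text \<open>The entrywise modulus of an eigenvector for an eigenvalue of maximal modulus. This avoids
  Perron-Frobenius theory.\<close>

lemma ex_subinvariant_vector:
  assumes G: "simple_graph G" "verts G \<noteq> {}"
  obtains x :: "'a \<Rightarrow> real" and u where "\<And>v. 0 \<le> x v" "\<And>v. x v \<le> 1" "u \<in> verts G" "x u = 1"
    "\<And>v. v \<in> verts G \<Longrightarrow> \<rho> G * x v \<le> (\<Sum>w | w \<in> verts G \<and> {v, w} \<in> edges G. x w)"
proof -
  obtain xs where xs: "enumerates xs G" using ex_enumerates[OF G(1)] by blast
  define n where "n = length xs"
  let ?A = "adjacency_matrix G xs"
  have A: "?A \<in> carrier_mat n n" by (simp add: adjacency_matrix_def n_def)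
  have n: "n > 0" using xs G(2) by (auto simp: enumerates_def n_def)
  obtain c where c: "eigenvalue ?A c" "norm c = \<rho> G"
    using spectral_radius_mem_max(1)[OF A n] graph_spectral_radius_eq[OF xs] by (auto simp: spectrum_def)
  obtain y where y: "y \<in> carrier_vec n" "y \<noteq> 0\<^sub>v n" "?A *\<^sub>v y = c \<cdot>\<^sub>v y"
    using c(1) A unfolding eigenvalue_def eigenvector_def by auto
  define idx where "idx = the_inv_into {..<n} ((!) xs)"
  have b: "bij_betw ((!) xs) {..<n} (verts G)"
    using xs by (auto simp: enumerates_def n_def intro: bij_betw_nth)
  have idx: "idx (xs ! i) = i" if "i < n" for i
    using b that by (auto simp: idx_def bij_betw_def the_inv_into_f_f)
  \<comment> \<open>Setting \<open>z\<close> to zero off the vertex set makes the bounds on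
    \<open>x\<close> hold for every element of the type, not just for vertices.\<close>
  define z where "z v = (if v \<in> verts G then norm (y $ idx v) else 0)" for v
  have fin: "finite (verts G)" using G by (simp add: simple_graph_def)
  have ex: "\<exists>i<n. xs ! i = v" if "v \<in> verts G" for v
    using xs that unfolding enumerates_def n_def by (metis in_set_conv_nth)
  have sub: "\<rho> G * z v \<le> (\<Sum>w | w \<in> verts G \<and> {v, w} \<in> edges G. z w)" if v: "v \<in> verts G" for v
  proof -
    obtain i where i: "i < n" "xs ! i = v" using ex[OF v] by blast
    have "\<rho> G * z v = norm ((c \<cdot>\<^sub>v y) $ i)"
      using i v idx[of i] c(2) y(1) by (simp add: z_def norm_mult)
    also have "\<dots> = norm ((?A *\<^sub>v y) $ i)" by (simp add: y(3))
    also have "\<dots> = norm (\<Sum>j | j < n \<and> {xs ! i, xs ! j} \<in> edges G. y $ j)"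
      using adjacency_matrix_mult_index[of xs i y G] xs i y(1) by (simp add: enumerates_def n_def)
    also have "\<dots> \<le> (\<Sum>j | j < n \<and> {xs ! i, xs ! j} \<in> edges G. norm (y $ j))" by (rule norm_sum)
    also have "\<dots> = (\<Sum>j | j < n \<and> {xs ! i, xs ! j} \<in> edges G. z (xs ! j))"
    proof (intro sum.cong refl)
      fix j assume "j \<in> {j. j < n \<and> {xs ! i, xs ! j} \<in> edges G}"
      then have "j < n" by simp
      then have "xs ! j \<in> verts G" using b by (auto simp: bij_betw_def)
      then show "norm (y $ j) = z (xs ! j)" using idx[OF \<open>j < n\<close>] by (simp add: z_def)
    qed
    also have "\<dots> = (\<Sum>w | w \<in> verts G \<and> {v, w} \<in> edges G. z w)"
      unfolding n_def i(2) by (rule sum_enumerates[OF xs])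
    finally show ?thesis .
  qed
  obtain u where u: "u \<in> verts G" "\<And>v. v \<in> verts G \<Longrightarrow> z v \<le> z u"
  proof -
    have "Max (z ` verts G) \<in> z ` verts G" using fin G(2) by (intro Max_in) auto
    then obtain u where "u \<in> verts G" "z u = Max (z ` verts G)" by auto
    then show ?thesis using that[of u] fin by auto
  qed
  have z0: "z v \<ge> 0" for v by (simp add: z_def)
  have pos: "z u > 0"
  proof (rule ccontr)
    assume "\<not> z u > 0"
    then have zz: "z v = 0" if "v \<in> verts G" for v using u(2)[OF that] z0[of v] by linarith
    have "y $ i = 0" if "i < n" for i
    proof -
      have "xs ! i \<in> verts G" using b that by (auto simp: bij_betw_def)
      then show ?thesis using zz[of "xs ! i"] idx[OF that] by (simp add: z_def)
    qed
    then have "y = 0\<^sub>v n" using y(1) by (intro eq_vecI) auto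
    then show False using y(2) by simp
  qed
  show ?thesis
  proof (rule that[of "\<lambda>v. z v / z u" u])
    show "z v / z u \<le> 1" for v
      using u(2)[of v] pos by (cases "v \<in> verts G") (auto simp: z_def)
    show "\<rho> G * (z v / z u) \<le> (\<Sum>w | w \<in> verts G \<and> {v, w} \<in> edges G. z w / z u)" if "v \<in> verts G" for v
      using divide_right_mono[OF sub[OF that], of "z u"] pos by (simp add: sum_divide_distrib)
  qed (use z0 pos u in auto)
qed

section \<open>Degrees, edge counts and embedded copies of a graph\<close>

lemma simple_graph_edge: "simple_graph G \<Longrightarrow> {u, v} \<in> edges G \<Longrightarrow> u \<in> verts G \<and> v \<in> verts G \<and> u \<noteq> v"
  by (auto simp: simple_graph_def doubleton_eq_iff dest!: subsetD)

lemma vertex_degree_eq: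
  assumes "simple_graph G"
  shows "vertex_degree G v = card {w \<in> verts G. {v, w} \<in> edges G}"
proof -
  have "{e \<in> edges G. v \<in> e} = (\<lambda>w. {v, w}) ` {w \<in> verts G. {v, w} \<in> edges G}"
  proof (intro equalityI subsetI)
    fix e assume e: "e \<in> {e \<in> edges G. v \<in> e}"
    then obtain a b where ab: "e = {a, b}" "a \<in> verts G" "b \<in> verts G"
      using assms unfolding simple_graph_def by blast
    then have "e = {v, a} \<or> e = {v, b}" using e by auto
    then show "e \<in> (\<lambda>w. {v, w}) ` {w \<in> verts G. {v, w} \<in> edges G}" using e ab by blast
  qed auto
  moreover have "inj_on (\<lambda>w. {v, w}) A" for A by (auto simp: inj_on_def doubleton_eq_iff)
  ultimately show ?thesis by (simp add: vertex_degree_def card_image)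
qed

text \<open>Double counting of the incident pairs of a vertex and an edge.\<close>

lemma sum_vertex_degree:
  assumes "simple_graph G"
  shows "(\<Sum>v\<in>verts G. vertex_degree G v) = 2 * card (edges G)"
proof -
  have fin: "finite (verts G)" "finite (edges G)"
  proof -
    show "finite (verts G)" using assms by (simp add: simple_graph_def)
    moreover have "edges G \<subseteq> Pow (verts G)" using assms by (auto simp: simple_graph_def)
    ultimately show "finite (edges G)" using finite_subset by blast
  qed
  have "(\<Sum>v\<in>verts G. vertex_degree G v) = (\<Sum>v\<in>verts G. \<Sum>e | e \<in> edges G \<and> v \<in> e. 1)"
    by (simp add: vertex_degree_def)
  also have "\<dots> = (\<Sum>e\<in>edges G. \<Sum>v | v \<in> verts G \<and> v \<in> e. 1)"
    by (rule sum.swap_restrict[OF fin])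
  also have "\<dots> = (\<Sum>e\<in>edges G. 2)"
  proof (intro sum.cong refl)
    fix e assume "e \<in> edges G"
    then obtain a b where "e = {a, b}" "a \<in> verts G" "b \<in> verts G" "a \<noteq> b"
      using assms unfolding simple_graph_def by blast
    moreover from this have "{v \<in> verts G. v \<in> e} = {a, b}" by auto
    ultimately show "(\<Sum>v | v \<in> verts G \<and> v \<in> e. 1) = (2 :: nat)" by simp
  qed
  finally show ?thesis by simp
qed

text \<open>The copy \<open>H\<close> keeps only the images of the edges of \<open>F\<close>, so
  further edges of \<open>G\<close> between these vertices do no harm, and injectivity makes the
  inverse of \<open>g\<close> an isomorphism.\<close>

lemma inj_on_imp_not_graph_free:
  assumes F: "simple_graph F" and g: "inj_on g (verts F)" "g ` verts F \<subseteq> verts G"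
    and e: "\<And>i j. {i, j} \<in> edges F \<Longrightarrow> {g i, g j} \<in> edges G"
  shows "\<not> graph_free F G"
proof -
  define H where "H = \<lparr>verts = g ` verts F, edges = (image g) ` edges F\<rparr>"
  define f where "f = the_inv_into (verts F) g"
  have Fe: "\<exists>i j. a = {i, j} \<and> i \<in> verts F \<and> j \<in> verts F \<and> i \<noteq> j" if "a \<in> edges F" for a
    using F that unfolding simple_graph_def by blast
  have "edges H \<subseteq> {{u, v} | u v. u \<in> verts H \<and> v \<in> verts H \<and> u \<noteq> v}"
  proof
    fix d assume "d \<in> edges H"
    then obtain a where "a \<in> edges F" "d = g ` a" by (auto simp: H_def)
    moreover from this obtain i j where "a = {i, j}" "i \<in> verts F" "j \<in> verts F" "i \<noteq> j" using Fe by blast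
    ultimately have "d = {g i, g j}" "g i \<in> verts H" "g j \<in> verts H" "g i \<noteq> g j"
      using g(1) by (auto simp: H_def inj_on_def)
    then show "d \<in> {{u, v} | u v. u \<in> verts H \<and> v \<in> verts H \<and> u \<noteq> v}" by blast
  qed
  moreover have "finite (verts H)" using F by (simp add: H_def simple_graph_def)
  ultimately have "simple_graph H" by (simp add: simple_graph_def)
  moreover have "edges H \<subseteq> edges G"
  proof
    fix d assume "d \<in> edges H"
    then obtain a where a: "a \<in> edges F" "d = g ` a" by (auto simp: H_def)
    then show "d \<in> edges G" using Fe[OF a(1)] e by auto
  qed
  ultimately have "subgraph H G" using g(2) by (simp add: subgraph_def H_def)
  moreover have "H \<cong>\<^sub>g F"
    unfolding graph_iso_def
  proof (intro exI[of _ f] conjI ballI)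
    show "bij_betw f (verts H) (verts F)"
      unfolding f_def H_def using g(1) by (simp add: bij_betw_the_inv_into inj_on_imp_bij_betw)
    fix u v assume "u \<in> verts H" "v \<in> verts H"
    then obtain i j where ij: "i \<in> verts F" "u = g i" "j \<in> verts F" "v = g j" by (auto simp: H_def)
    then have fi: "f u = i" "f v = j" using g(1) by (auto simp: f_def the_inv_into_f_f)
    show "{u, v} \<in> edges H \<longleftrightarrow> {f u, f v} \<in> edges F"
    proof
      assume "{u, v} \<in> edges H"
      then obtain a where a: "a \<in> edges F" "{g i, g j} = g ` a" using ij by (auto simp: H_def)
      have "a \<subseteq> verts F" using Fe[OF a(1)] by auto
      moreover have "g ` {i, j} = g ` a" using a by simp
      ultimately have "{i, j} = a" using g(1) ij by (metis inj_on_image_eq_iff insert_subset empty_subsetI)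
      then show "{f u, f v} \<in> edges F" using a fi by simp
    next
      assume "{f u, f v} \<in> edges F"
      then have "g ` {i, j} \<in> image g ` edges F" unfolding fi by (rule imageI)
      then show "{u, v} \<in> edges H" using ij by (simp add: H_def)
    qed
  qed
  ultimately show ?thesis unfolding graph_free_def by blast
qed

lemma edges_cycle_plus_5:
  "edges (cycle_plus 5) = {{0, 1}, {1, 2}, {2, 3}, {3, 4}, {4, 0}, {0, 5}, {1, 5}}"
proof -
  have "{{i, (i + 1) mod 5} | i. i < 5} = (\<lambda>i. {i, (i + 1) mod 5}) ` {..<5 :: nat}" by auto
  also have "{..<5 :: nat} = {0, 1, 2, 3, 4}" by auto
  finally have eq: "{{i, (i + 1) mod 5} | i. i < 5} = {{0, 1}, {1, 2}, {2, 3}, {3, 4}, {4, 0 :: nat}}"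
    by (simp add: numeral_2_eq_2[symmetric])
  show ?thesis unfolding cycle_plus_def graph.select_convs eq by (simp only: Un_insert_left Un_empty_left)
qed

lemma C5_plus_not_free:
  fixes G :: "'a graph"
  assumes G: "simple_graph G"
    and e: "{v0, v1} \<in> edges G" "{v1, v2} \<in> edges G" "{v2, v3} \<in> edges G" "{v3, v4} \<in> edges G"
      "{v4, v0} \<in> edges G" "{v0, w} \<in> edges G" "{v1, w} \<in> edges G"
    and d: "distinct [v0, v1, v2, v3, v4, w]"
  shows "\<not> graph_free (cycle_plus 5) G"
proof -
  define g where "g i = [v0, v1, v2, v3, v4, w] ! i" for i
  have V: "verts (cycle_plus 5) = {..<6}" by (auto simp: cycle_plus_def)
  have g: "g 0 = v0" "g 1 = v1" "g 2 = v2" "g 3 = v3" "g 4 = v4" "g 5 = w" by (simp_all add: g_def)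
  have "inj_on g {..<6}"
    unfolding g_def using d by (intro inj_on_nth) auto
  moreover have "g ` {..<6} \<subseteq> verts G"
  proof -
    have "g ` {..<6} \<subseteq> set [v0, v1, v2, v3, v4, w]"
      unfolding g_def by (auto simp del: nth_Cons_numeral list.set intro!: nth_mem)
    also have "\<dots> \<subseteq> verts G" using e simple_graph_edge[OF G] by simp
    finally show ?thesis .
  qed
  moreover have "{g i, g j} \<in> edges G" if "{i, j} \<in> edges (cycle_plus 5)" for i j
    using that e g unfolding edges_cycle_plus_5 by (auto simp: doubleton_eq_iff insert_commute)
  ultimately show ?thesis
    by (intro inj_on_imp_not_graph_free simple_graph_cycle_plus) (auto simp: V)
qed

section \<open>The extremal graph and a lower bound for its spectral radius\<close>

lemma S_minus_edge:
  assumes "n \<ge> 4"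
  shows "{u, v} \<in> edges (S_minus n 2) \<longleftrightarrow> u < n \<and> v < n \<and> u \<noteq> v \<and> (u < 2 \<or> v < 2) \<and>
    \<not> (u = 0 \<and> v = n - 1) \<and> \<not> (v = 0 \<and> u = n - 1)"
proof -
  have "{u, v} \<in> edges (S_graph n 2) \<longleftrightarrow> u < n \<and> v < n \<and> u \<noteq> v \<and> (u < 2 \<or> v < 2)"
    unfolding S_graph_def by (auto simp: doubleton_eq_iff)
  then show ?thesis by (auto simp: S_minus_def doubleton_eq_iff)
qed

lemma S_minus_verts: "verts (S_minus n k) = {..<n}"
  by (simp add: S_minus_def S_graph_def)

text \<open>The classes \<open>{0}\<close>, \<open>{1}\<close>, \<open>{n - 1}\<close> and
  \<open>{2..<n - 1}\<close> form an equitable partition, and the quartic is the characteristic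
  polynomial of its quotient matrix. A positive root has an explicit eigenvector that is constant on
  each class.\<close>

lemma S_minus_spectral_radius_ge:
  assumes n: "n \<ge> 4" and c: "c ^ 4 - (2 * real n - 4) * c\<^sup>2 - (2 * real n - 6) * c + (real n - 3) = 0" "c > 0"
  shows "c \<le> \<rho> (S_minus n 2)"
proof -
  let ?S = "S_minus n 2"
  \<comment> \<open>Up to scaling, these values solve the eigenvector equations at
    \<open>n - 1\<close> and at the middle vertices, and the difference of those at 0 and 1. What
    remains is the quartic.\<close>
  define x :: "nat \<Rightarrow> real" where "x v = (if v = 0 then c * (c\<^sup>2 + c - 1) else if v = 1 then c\<^sup>2 * (c + 1)
    else if v = n - 1 then c * (c + 1) else 2 * c\<^sup>2 + 2 * c - 1)" for v
  have mid: "(\<Sum>w\<in>{2..<n - 1}. x w) = (real n - 3) * (2 * c\<^sup>2 + 2 * c - 1)"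
  proof -
    have "(\<Sum>w\<in>{2..<n - 1}. x w) = (\<Sum>w\<in>{2..<n - 1}. 2 * c\<^sup>2 + 2 * c - 1)"
      by (intro sum.cong) (auto simp: x_def)
    also have "\<dots> = real (n - 3) * (2 * c\<^sup>2 + 2 * c - 1)" by (simp add: numeral_3_eq_3)
    also have "real (n - 3) = real n - 3" using n by simp
    finally show ?thesis .
  qed
  \<comment> \<open>The quartic, solved for the total weight of the middle vertices; this removes
    \<open>n\<close> from the equations at 0 and 1.\<close>
  have key: "(real n - 3) * (2 * c\<^sup>2 + 2 * c - 1) = c ^ 4 - 2 * c\<^sup>2"
    using c(1) by (simp add: algebra_simps)
  have x: "x 0 = c * (c\<^sup>2 + c - 1)" "x 1 = c\<^sup>2 * (c + 1)" "x (n - 1) = c * (c + 1)"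
    using n by (auto simp: x_def)
  have eig: "(\<Sum>w | w \<in> verts ?S \<and> {v, w} \<in> edges ?S. x w) = c * x v" if v: "v \<in> verts ?S" for v
  proof -
    have vn: "v < n" using v by (simp add: S_minus_verts)
    consider "v = 0" | "v = 1" | "v = n - 1" | "2 \<le> v" "v < n - 1" using vn by linarith
    then show ?thesis
    proof cases
      case 1
      have "{w \<in> verts ?S. {v, w} \<in> edges ?S} = insert 1 {2..<n - 1}"
        using n 1 by (auto simp: S_minus_verts S_minus_edge)
      then have "(\<Sum>w | w \<in> verts ?S \<and> {v, w} \<in> edges ?S. x w) = x 1 + (\<Sum>w\<in>{2..<n - 1}. x w)" by simp
      also have "\<dots> = c * x 0"
        unfolding x mid key by (simp add: algebra_simps power2_eq_square power4_eq_xxxx)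
      finally show ?thesis using 1 by simp
    next
      case 2
      have "{w \<in> verts ?S. {v, w} \<in> edges ?S} = insert 0 (insert (n - 1) {2..<n - 1})"
        using n 2 by (auto simp: S_minus_verts S_minus_edge)
      then have "(\<Sum>w | w \<in> verts ?S \<and> {v, w} \<in> edges ?S. x w) = x 0 + x (n - 1) + (\<Sum>w\<in>{2..<n - 1}. x w)"
        using n by simp
      also have "\<dots> = c * x 1"
        unfolding x mid key by (simp add: algebra_simps power2_eq_square power4_eq_xxxx)
      finally show ?thesis using 2 by simp
    next
      case 3
      have "{w \<in> verts ?S. {v, w} \<in> edges ?S} = {1}"
        using n 3 by (auto simp: S_minus_verts S_minus_edge)
      then show ?thesis using x 3 by (simp add: algebra_simps power2_eq_square)
    next
      case 4
      have "{w \<in> verts ?S. {v, w} \<in> edges ?S} = {0, 1}"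
        using n 4 by (auto simp: S_minus_verts S_minus_edge)
      then have "(\<Sum>w | w \<in> verts ?S \<and> {v, w} \<in> edges ?S. x w) = x 0 + x 1" by simp
      moreover have xv: "x v = 2 * c\<^sup>2 + 2 * c - 1" using 4 by (simp add: x_def)
      ultimately show ?thesis unfolding x xv by (simp add: algebra_simps power2_eq_square)
    qed
  qed
  have "1 \<in> verts ?S" "x 1 \<noteq> 0" using n c(2) x by (auto simp: S_minus_verts)
  then show ?thesis using spectral_radius_ge_eigenvalue[OF simple_graph_S_minus] eig by blast
qed

text \<open>At the point \<open>a\<close> with \<open>a\<^sup>2 - a = m - 3 / 2\<close> the characteristic quartic takes the value
  \<open>- 1 / 4\<close>.\<close>

lemma S_minus_spectral_radius_bound:
  fixes r :: real
  assumes n: "n \<ge> 4" and r: "\<rho> (S_minus n 2) \<le> r"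
  shows "r\<^sup>2 - r > 2 * real n - 4 - 3 / 2" "r > 1"
proof -
  define m where "m = 2 * real n - 4"
  define p where "p c = c ^ 4 - m * c\<^sup>2 - (m - 2) * c + (m / 2 - 1)" for c :: real
  define s where "s = sqrt (4 * m - 5)"
  define a where "a = (1 + s) / 2"
  have m: "m \<ge> 4" using n by (simp add: m_def)
  have s2: "s\<^sup>2 = 4 * m - 5" "s \<ge> 0" using m by (auto simp: s_def)
  have s1: "s \<ge> 1" unfolding s_def using m by simp
  have a2: "a\<^sup>2 = a + m - 3 / 2" using s2 by (simp add: a_def power2_eq_square field_simps)
  have a1: "a \<ge> 1" using s1 by (simp add: a_def)
  have "a ^ 4 = (a + m - 3 / 2)\<^sup>2" using a2 by (metis power2_eq_square power4_eq_xxxx mult.assoc)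
  also have "\<dots> = a\<^sup>2 + 2 * a * (m - 3 / 2) + (m - 3 / 2)\<^sup>2" by (simp add: power2_eq_square algebra_simps)
  finally have pa: "p a = - 1 / 4"
    unfolding p_def a2 by (simp add: power2_eq_square field_simps)
  have mm: "4 * m \<le> m * m" using m by simp
  have "(2 * m - 1)\<^sup>2 = 4 * (m * m) - 4 * m + 1" by (simp add: power2_eq_square algebra_simps)
  then have "4 * m - 5 \<le> (2 * m - 1)\<^sup>2" using mm m by linarith
  then have "s \<le> 2 * m - 1" unfolding s_def using m by (intro real_le_lsqrt) auto
  then have am: "a \<le> m" by (simp add: a_def)
  \<comment> \<open>\<open>m\<close> is a crude right end for the intermediate value theorem; since
    \<open>p a\<close> is negative, a root lies strictly to the right of \<open>a\<close>.\<close>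
  have "p m \<ge> 0"
  proof -
    have "p m = m * m * (m * m) - m * m * m - m * m + 2 * m + (m / 2 - 1)"
      by (simp add: p_def power2_eq_square power4_eq_xxxx algebra_simps)
    moreover have "m * m * m + m * m \<le> m * m * (m * m)"
    proof -
      have "m + 1 \<le> m * m" using mm m by linarith
      then show ?thesis using mult_left_mono[of "m + 1" "m * m" "m * m"] by (simp add: algebra_simps)
    qed
    ultimately show ?thesis using m by linarith
  qed
  moreover have "continuous_on {a..m} p" unfolding p_def by (intro continuous_intros)
  ultimately obtain c where c: "a \<le> c" "c \<le> m" "p c = 0"
    using IVT'[of p a 0 m] pa am by auto
  have "c \<noteq> a" using c pa by auto
  then have ca: "c > a" using c by simp
  have "c \<le> \<rho> (S_minus n 2)"
    using c(3) ca a1 n by (intro S_minus_spectral_radius_ge) (auto simp: p_def m_def field_simps)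
  then have ra: "r > a" using ca r by linarith
  then show "r > 1" using a1 by linarith
  have "a * (a - 1) < r * (r - 1)" using a1 ra by (intro mult_strict_mono) auto
  then show "r\<^sup>2 - r > 2 * real n - 4 - 3 / 2" using a2 by (simp add: m_def power2_eq_square algebra_simps)
qed

section \<open>Graphs with a large subinvariant vector\<close>

locale C5_plus_free =
  fixes V :: "'a set" and E :: "'a \<Rightarrow> 'a \<Rightarrow> bool"
  assumes finite_V: "finite V"
    and E_sym: "E v w \<Longrightarrow> E w v"
    and E_irrefl: "\<not> E v v"
    and E_V: "E v w \<Longrightarrow> v \<in> V"
    and no_C5_plus: "\<lbrakk>E v0 v1; E v1 v2; E v2 v3; E v3 v4; E v4 v0; E v0 w; E v1 w;
      distinct [v0, v1, v2, v3, v4, w]\<rbrakk> \<Longrightarrow> False"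

text \<open>Only an inequality is asked of \<open>x\<close>, so the modulus of an eigenvector
  qualifies. \<open>r_large\<close> comes from the comparison with the extremal graph, and
  \<open>r_ge_9\<close> then follows from \<open>m >= 74\<close>.\<close>

locale C5_plus_free_subeigenvector = C5_plus_free V E for V :: "'a set" and E +
  fixes x :: "'a \<Rightarrow> real" and r :: real and m :: nat and u :: 'a
  assumes x_nonneg: "x v \<ge> 0"
    and x_le_1: "x v \<le> 1"
    and x_u: "x u = 1" and u_V: "u \<in> V"
    and subinvariant: "v \<in> V \<Longrightarrow> r * x v \<le> (\<Sum>w | w \<in> V \<and> E v w. x w)"
    and r_ge_9: "r \<ge> 9"
    and r_large: "r\<^sup>2 - r > m - 3 / 2"
    and handshake: "(\<Sum>v\<in>V. card {w \<in> V. E v w}) = 2 * m"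
    and no_isolated: "v \<in> V \<Longrightarrow> \<exists>w. E v w"
begin

section \<open>The neighbourhood of \<open>u\<close>, the remaining vertices and the main
  inequality\<close>

definition N where "N = {v \<in> V. E u v}"
definition W where "W = {v \<in> V. \<not> E u v \<and> v \<noteq> u}"
definition nN where "nN v = {z \<in> N. E v z}"
definition nW where "nW v = {z \<in> W. E v z}"
definition dN :: "'a \<Rightarrow> real" where "dN v = card (nN v)"
definition dW :: "'a \<Rightarrow> real" where "dW v = card (nW v)"

text \<open>The edges at \<open>w \<in> W\<close> cost \<open>dN w * (1 - x w) + dW w / 2\<close> in the main inequality;
  \<open>cost w\<close> is the share of each of the \<open>dN w\<close> neighbours of \<open>w\<close> in \<open>N\<close>.\<close>

definition cost where "cost w = 1 - x w + dW w / (2 * dN w)"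
definition pen where "pen v = (\<Sum>w\<in>nW v. cost w)"
text \<open>Half of each edge inside \<open>N\<close> is charged to each of its ends, so the sum
  over a component subtracts its number of edges.\<close>

definition gain where "gain v = (dN v - 1) * x v - dN v / 2 - pen v"

lemma finite_N [simp]: "finite N" and finite_W [simp]: "finite W"
  and finite_nN [simp]: "finite (nN v)" and finite_nW [simp]: "finite (nW v)"
  by (auto simp: N_def W_def nN_def nW_def finite_V)

lemma E_commute: "E v w \<longleftrightarrow> E w v" using E_sym by blast

lemma V_split: "V = insert u (N \<union> W)" "u \<notin> N" "u \<notin> W" "N \<inter> W = {}"
  using u_V E_irrefl by (auto simp: N_def W_def)

lemma N_E: "v \<in> N \<Longrightarrow> E u v" "v \<in> N \<Longrightarrow> E v u" by (auto simp: N_def E_sym)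
lemma W_E: "v \<in> W \<Longrightarrow> \<not> E u v" "v \<in> W \<Longrightarrow> \<not> E v u" using E_sym by (auto simp: W_def)

lemma N_V: "v \<in> N \<Longrightarrow> v \<in> V" and W_V: "v \<in> W \<Longrightarrow> v \<in> V" by (auto simp: N_def W_def)

lemma nbr_u: "{w \<in> V. E u w} = N" by (auto simp: N_def)

lemma nbr_N: "v \<in> N \<Longrightarrow> {w \<in> V. E v w} = insert u (nN v \<union> nW v)"
  using N_E(2)[of v] u_V unfolding nN_def nW_def N_def W_def by blast
lemma nbr_W: "v \<in> W \<Longrightarrow> {w \<in> V. E v w} = nN v \<union> nW v"
  using W_E(2)[of v] unfolding nN_def nW_def N_def W_def by blast

lemma nN_nW_disjoint: "nN v \<inter> nW v = {}" "u \<notin> nN v" "u \<notin> nW v"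
  using V_split by (auto simp: nN_def nW_def)

lemma subinvariant_u: "r \<le> (\<Sum>v\<in>N. x v)"
  using subinvariant[OF u_V] by (simp add: nbr_u x_u)
lemma subinvariant_N: "v \<in> N \<Longrightarrow> r * x v \<le> 1 + (\<Sum>w\<in>nN v. x w) + (\<Sum>w\<in>nW v. x w)"
  using subinvariant[of v] nN_nW_disjoint[of v]
  by (simp add: nbr_N x_u sum.union_disjoint N_V)
lemma subinvariant_W: "v \<in> W \<Longrightarrow> r * x v \<le> (\<Sum>w\<in>nN v. x w) + (\<Sum>w\<in>nW v. x w)"
  using subinvariant[of v] nN_nW_disjoint[of v]
  by (simp add: nbr_W sum.union_disjoint W_V)

lemma sum_x_le_card: "finite A \<Longrightarrow> (\<Sum>v\<in>A. x v) \<le> card A"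
  using sum_mono[of A x "\<lambda>_. 1"] x_le_1 by simp

lemma dN_nonneg [simp]: "0 \<le> dN v" and dW_nonneg [simp]: "0 \<le> dW v"
  by (auto simp: dN_def dW_def)

lemma cost_nonneg: "cost w \<ge> 0" using x_le_1[of w] by (simp add: cost_def)
lemma pen_nonneg: "pen v \<ge> 0" by (simp add: pen_def cost_nonneg sum_nonneg)

text \<open>Double counting of the edges between \<open>N\<close> and \<open>W\<close>: each
  \<open>w\<close> is met once from each of its \<open>dN w\<close> neighbours.\<close>

lemma sum_N_nW: "(\<Sum>v\<in>N. \<Sum>w\<in>nW v. f w) = (\<Sum>w\<in>W. dN w * f w)"
proof -
  have "(\<Sum>v\<in>N. \<Sum>w\<in>nW v. f w) = (\<Sum>w\<in>W. \<Sum>v | v \<in> N \<and> E v w. f w)"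
    unfolding nW_def by (rule sum.swap_restrict) auto
  also have "\<dots> = (\<Sum>w\<in>W. dN w * f w)"
    by (intro sum.cong refl) (simp add: dN_def nN_def E_commute)
  finally show ?thesis .
qed

lemma sum_N_nN: "(\<Sum>v\<in>N. \<Sum>w\<in>nN v. f w) = (\<Sum>w\<in>N. dN w * f w)"
proof -
  have "(\<Sum>v\<in>N. \<Sum>w\<in>nN v. f w) = (\<Sum>w\<in>N. \<Sum>v | v \<in> N \<and> E v w. f w)"
    unfolding nN_def by (rule sum.swap_restrict) auto
  also have "\<dots> = (\<Sum>w\<in>N. dN w * f w)"
    by (intro sum.cong refl) (simp add: dN_def nN_def E_commute)
  finally show ?thesis .
qed

text \<open>Half of the handshake sum, split over \<open>u\<close>, \<open>N\<close> and
  \<open>W\<close>. Edges between \<open>N\<close> and \<open>W\<close> are seen from both sides and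
  hence appear with full weight.\<close>

lemma edge_count: "real m = card N + (\<Sum>v\<in>N. dN v) / 2 + (\<Sum>w\<in>W. dN w) + (\<Sum>w\<in>W. dW w) / 2"
proof -
  have "real (2 * m) = (\<Sum>v\<in>V. real (card {w \<in> V. E v w}))"
    by (simp add: handshake[symmetric])
  also have "\<dots> = card N + (\<Sum>v\<in>N. real (card {w \<in> V. E v w})) + (\<Sum>v\<in>W. real (card {w \<in> V. E v w}))"
    using V_split(2-4) nbr_u by (subst (1) V_split(1)) (simp add: sum.union_disjoint)
  also have "(\<Sum>v\<in>N. real (card {w \<in> V. E v w})) = (\<Sum>v\<in>N. 1 + dN v + dW v)"
    using nN_nW_disjoint
    by (intro sum.cong refl) (simp add: nbr_N dN_def dW_def card_Un_disjoint)
  also have "(\<Sum>v\<in>W. real (card {w \<in> V. E v w})) = (\<Sum>v\<in>W. dN v + dW v)"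
    using nN_nW_disjoint
    by (intro sum.cong refl) (simp add: nbr_W dN_def dW_def card_Un_disjoint)
  also have "(\<Sum>v\<in>N. 1 + dN v + dW v) = card N + (\<Sum>v\<in>N. dN v) + (\<Sum>v\<in>N. dW v)"
    by (simp add: sum.distrib)
  also have "(\<Sum>v\<in>N. dW v) = (\<Sum>w\<in>W. dN w)"
    using sum_N_nW[of "\<lambda>_. 1"] by (simp add: dW_def)
  finally show ?thesis by (simp add: sum.distrib)
qed

text \<open>Multiply \<open>subinvariant_u\<close> by \<open>r - 1\<close>, bound each
  \<open>r * x v\<close> by \<open>subinvariant_N\<close>, and compare with \<open>r_large\<close>
  after inserting \<open>edge_count\<close>. The factor \<open>r - 1\<close> produces the
  \<open>- 1\<close> in \<open>dN v - 1\<close>.\<close>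

lemma main_inequality:
  "(\<Sum>v\<in>N. gain v) > - 3 / 2 + (\<Sum>w | w \<in> W \<and> dN w = 0. dW w) / 2"
proof -
  have "(r - 1) * r \<le> (r - 1) * (\<Sum>v\<in>N. x v)"
    using subinvariant_u r_ge_9 by (intro mult_left_mono) auto
  also have "\<dots> = (\<Sum>v\<in>N. r * x v - x v)"
    by (simp add: sum_distrib_left algebra_simps)
  also have "\<dots> \<le> (\<Sum>v\<in>N. 1 + (\<Sum>w\<in>nN v. x w) + (\<Sum>w\<in>nW v. x w) - x v)"
    using subinvariant_N by (intro sum_mono) fastforce
  also have "\<dots> = card N + (\<Sum>v\<in>N. dN v * x v) + (\<Sum>w\<in>W. dN w * x w) - (\<Sum>v\<in>N. x v)"
    by (simp add: sum.distrib sum_subtractf sum_N_nN sum_N_nW)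
  finally have 1: "r\<^sup>2 - r \<le> card N + (\<Sum>v\<in>N. dN v * x v) + (\<Sum>w\<in>W. dN w * x w) - (\<Sum>v\<in>N. x v)"
    by (simp add: algebra_simps power2_eq_square)
  have "(\<Sum>v\<in>N. pen v) = (\<Sum>w\<in>W. dN w * cost w)"
    unfolding pen_def by (rule sum_N_nW)
  \<comment> \<open>If \<open>dN w = 0\<close>, then \<open>dN w * cost w\<close> vanishes and
    misses \<open>dW w / 2\<close>; the conditional corrects this and becomes the extra sum of the
    lemma.\<close>
  also have "\<dots> = (\<Sum>w\<in>W. dN w - dN w * x w + (dW w / 2 - (if dN w = 0 then dW w / 2 else 0)))"
    by (intro sum.cong refl) (simp add: cost_def field_simps)
  also have "\<dots> = (\<Sum>w\<in>W. dN w) - (\<Sum>w\<in>W. dN w * x w) + (\<Sum>w\<in>W. dW w) / 2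
      - (\<Sum>w | w \<in> W \<and> dN w = 0. dW w) / 2"
    by (simp add: sum.distrib sum_subtractf sum_divide_distrib sum.inter_filter if_distrib[of "\<lambda>t. t / 2"] cong: if_cong)
  finally have 2: "(\<Sum>v\<in>N. pen v) = \<dots>" .
  have "(\<Sum>v\<in>N. gain v) = (\<Sum>v\<in>N. dN v * x v) - (\<Sum>v\<in>N. x v) - (\<Sum>v\<in>N. dN v) / 2 - (\<Sum>v\<in>N. pen v)"
    by (simp add: gain_def sum_subtractf algebra_simps sum_divide_distrib)
  then show ?thesis using 1 2 edge_count r_large by argo
qed

text \<open>The vertices \<open>u\<close>, \<open>q\<close>, \<open>y\<close>, \<open>z\<close>,
  \<open>t\<close> form a 5-cycle and \<open>p\<close> completes a triangle on its edge from
  \<open>u\<close> to \<open>q\<close>. As \<open>y\<close> and \<open>z\<close> are arbitrary, the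
  path may run through \<open>W\<close>.\<close>

lemma no_path:
  assumes "p \<in> N" "q \<in> N" "t \<in> N" "E p q" "E q y" "E y z" "E z t"
    "distinct [u, p, q, y, z, t]"
  shows False
  using no_C5_plus[of u q y z t p] assms N_E[OF assms(1)] N_E[OF assms(2)] N_E[OF assms(3)] E_sym[OF assms(4)]
  by auto

text \<open>Since \<open>r >= 2 * dN w\<close>, a large \<open>x w\<close> forces many neighbours of
  \<open>w\<close> in \<open>W\<close>. The two terms \<open>1 - x w\<close> and
  \<open>dW w / (2 * dN w)\<close> thus always add up to at least 1/2.\<close>

lemma cost_ge:
  assumes "w \<in> W" "0 < dN w" "dN w \<le> 4"
  shows "cost w \<ge> x w / 2"
proof -
  have "r * x w \<le> dN w + dW w"
    using subinvariant_W[OF assms(1)] sum_x_le_card[of "nN w"] sum_x_le_card[of "nW w"]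
    by (simp add: dN_def dW_def)
  moreover have "2 * dN w * x w \<le> r * x w"
    using assms r_ge_9 x_nonneg by (intro mult_right_mono) auto
  ultimately have "dW w \<ge> (2 * x w - 1) * dN w" by (simp add: algebra_simps)
  then have "dW w / (2 * dN w) \<ge> (2 * x w - 1) / 2" using assms by (simp add: field_simps)
  then show ?thesis using x_le_1[of w] by (simp add: cost_def field_simps)
qed

text \<open>Lets the contribution of \<open>W\<close> in \<open>subinvariant_N\<close> be paid for
  by the penalty of \<open>v\<close>.\<close>

lemma pen_ge:
  assumes "v \<in> N" "\<And>w. w \<in> nW v \<Longrightarrow> dN w \<le> 4"
  shows "(\<Sum>w\<in>nW v. x w) \<le> 2 * pen v"
proof -
  have "x w \<le> 2 * cost w" if "w \<in> nW v" for w
  proof -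
    have "v \<in> nN w" using that assms(1) E_sym by (auto simp: nW_def nN_def)
    then have "dN w > 0" by (auto simp: dN_def card_gt_0_iff)
    then show ?thesis using cost_ge[of w] assms(2)[OF that] that by (auto simp: nW_def)
  qed
  then show ?thesis by (simp add: pen_def sum_distrib_left sum_mono)
qed

subsection \<open>The graph induced on the neighbourhood has no path on five vertices\<close>

text \<open>The unions of components of the graph induced on \<open>N\<close>.\<close>

definition N_closed where "N_closed Y \<longleftrightarrow> Y \<subseteq> N \<and> (\<forall>v\<in>Y. nN v \<subseteq> Y)"

text \<open>The two chords of the 4-cycle may be present or absent.\<close>

definition quad_block where
  "quad_block a b c d C \<longleftrightarrow> C = {a, b, c, d} \<and> distinct [a, b, c, d] \<and> C \<subseteq> N \<and>
     E a b \<and> E b c \<and> E c d \<and> E d a"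

definition triangle_block where
  "triangle_block a b c C \<longleftrightarrow> C = insert c (nN c) \<and> c \<in> N \<and> nN a = {b, c} \<and> nN b = {a, c} \<and>
     a \<in> nN c \<and> b \<in> nN c \<and> (\<forall>z\<in>nN c - {a, b}. nN z = {c})"

text \<open>A star, or a single edge, is the case where one of the two centres has no neighbour in
  \<open>N\<close> except the other.\<close>

definition tree_block where
  "tree_block a b C \<longleftrightarrow> C = nN a \<union> nN b \<and> a \<in> N \<and> b \<in> N \<and> E a b \<and> nN a \<inter> nN b = {} \<and>
     (\<forall>z\<in>nN a - {b}. nN z = {a}) \<and> (\<forall>z\<in>nN b - {a}. nN z = {b})"

lemma nN_iff: "z \<in> nN v \<longleftrightarrow> z \<in> N \<and> E v z" by (auto simp: nN_def)

lemma nN_sub: "nN v \<subseteq> N" by (auto simp: nN_def)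

lemma E_neq: "E v w \<Longrightarrow> v \<noteq> w" using E_irrefl by blast

lemma no_path_N:
  assumes "p \<in> N" "q \<in> N" "y \<in> N" "z \<in> N" "t \<in> N" "E p q" "E q y" "E y z" "E z t"
    "distinct [p, q, y, z, t]"
  shows False
  using no_path[of p q t y z] assms V_split(2) by auto

text \<open>A neighbour of \<open>a\<close> outside the block, followed by the cycle opened at
  \<open>a\<close>, would be a path on five vertices in \<open>N\<close>. The other corners follow
  by rotation.\<close>

lemma quad_block_closed:
  assumes "quad_block a b c d C"
  shows "N_closed C"
proof -
  have *: "z \<in> {a, b, c, d}" if "E a z" "z \<in> N" "distinct [a, b, c, d]" "{a, b, c, d} \<subseteq> N"
    "E a b" "E b c" "E c d" "E d a" for a b c d z
    using that no_path_N[of z a b c d] E_sym E_irrefl by auto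
  show ?thesis
    unfolding N_closed_def
  proof (intro conjI ballI subsetI)
    fix v z assume v: "v \<in> C" and z: "z \<in> nN v"
    from v assms consider "v = a" | "v = b" | "v = c" | "v = d" by (auto simp: quad_block_def)
    then show "z \<in> C"
    proof cases
      case 1 then show ?thesis using *[of a z b c d] assms z by (auto simp: quad_block_def nN_iff)
    next
      case 2 then show ?thesis using *[of b z c d a] assms z by (auto simp: quad_block_def nN_iff)
    next
      case 3 then show ?thesis using *[of c z d a b] assms z by (auto simp: quad_block_def nN_iff)
    next
      case 4 then show ?thesis using *[of d z a b c] assms z by (auto simp: quad_block_def nN_iff)
    qed
  qed (use assms in \<open>auto simp: quad_block_def\<close>)
qed

lemma triangle_block_closed:
  assumes "triangle_block a b c C"
  shows "N_closed C"
proof -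
  have C: "C = insert c (nN c)" "c \<in> N" "nN a = {b, c}" "nN b = {a, c}" "a \<in> nN c" "b \<in> nN c"
    and lf: "\<And>z. z \<in> nN c - {a, b} \<Longrightarrow> nN z = {c}"
    using assms unfolding triangle_block_def by blast+
  have "nN v \<subseteq> C" if "v \<in> C" for v
  proof -
    consider "v = c" | "v = a" | "v = b" | "v \<in> nN c - {a, b}" using \<open>v \<in> C\<close> C(1) by blast
    then show ?thesis using C lf[of v] by cases auto
  qed
  then show ?thesis using C by (simp add: N_closed_def nN_sub)
qed

lemma tree_block_closed:
  assumes "tree_block a b C"
  shows "N_closed C"
proof -
  have C: "C = nN a \<union> nN b" "b \<in> nN a" "a \<in> nN b"
    and lf: "\<And>z. z \<in> nN a - {b} \<Longrightarrow> nN z = {a}" "\<And>z. z \<in> nN b - {a} \<Longrightarrow> nN z = {b}"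
    using assms E_sym unfolding tree_block_def nN_iff by blast+
  have "nN v \<subseteq> C" if "v \<in> C" for v
  proof -
    consider "v = a" | "v = b" | "v \<in> nN a - {b}" | "v \<in> nN b - {a}" using \<open>v \<in> C\<close> C(1) by blast
    then show ?thesis using C lf[of v] by cases auto
  qed
  then show ?thesis using C by (simp add: N_closed_def nN_sub)
qed

lemma N_closed_Diff: "N_closed Y \<Longrightarrow> N_closed C \<Longrightarrow> N_closed (Y - C)"
  unfolding N_closed_def nN_def using E_sym by blast

text \<open>At most one corner has neighbours in \<open>N\<close> outside the triangle: a common
  outer neighbour of two corners closes a 4-cycle, and two different ones give a path on five
  vertices. Taking that corner as \<open>c'\<close>, a vertex attached to it has no further
  neighbour in \<open>N\<close>, since this would again extend to such a path.\<close>

lemma triangle_in_block: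
  assumes no4: "\<And>a b c d C. quad_block a b c d C \<Longrightarrow> \<not> C \<subseteq> Y"
    and Y: "N_closed Y"
    and t: "a \<in> Y" "b \<in> Y" "c \<in> Y" "E a b" "E b c" "E c a"
  shows "\<exists>a' b' c'. {a', b', c'} = {a, b, c} \<and> triangle_block a' b' c' (insert c' (nN c'))"
proof -
  have nY: "z \<in> Y" if "a \<in> Y" "E a z" "z \<in> N" for a z
    using Y that unfolding N_closed_def nN_def by blast
  have YN: "a \<in> Y \<Longrightarrow> a \<in> N" for a using Y by (auto simp: N_closed_def)
  have two: False if "E a p" "E b q" "p \<in> N" "q \<in> N" "p \<notin> {a, b, c}" "q \<notin> {a, b, c}"
    "a \<in> Y" "b \<in> Y" "c \<in> Y" "E a b" "E b c" "E c a" for a b c p q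
  proof (cases "p = q")
    case True
    then have "quad_block p a c b {p, a, c, b}"
      using that YN E_sym E_neq by (auto simp: quad_block_def)
    moreover have "{p, a, c, b} \<subseteq> Y" using that nY by blast
    ultimately show False using no4 by blast
  next
    case False
    then show False using no_path_N[of p a c b q] that YN E_sym E_neq by auto
  qed
  have one: "triangle_block a b c (insert c (nN c))"
    if t: "a \<in> N" "b \<in> N" "c \<in> N" "E a b" "E b c" "E c a" "nN a \<subseteq> {b, c}" "nN b \<subseteq> {a, c}" for a b c
  proof -
    have "nN z = {c}" if "z \<in> nN c - {a, b}" for z
    proof -
      have "y = c" if "y \<in> nN z" for y
      proof (rule ccontr)
        assume "y \<noteq> c"
        have "y \<noteq> a" "y \<noteq> b" using that t(1,2,7,8) \<open>z \<in> nN c - {a, b}\<close> E_sym E_irrefl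
          unfolding nN_def by blast+
        then show False
          using no_path_N[of y z c a b] t that \<open>y \<noteq> c\<close> \<open>z \<in> nN c - {a, b}\<close> E_sym E_neq
          by (auto simp: nN_iff)
      qed
      then show ?thesis using that t E_sym by (auto simp: nN_iff)
    qed
    then show ?thesis using t E_sym E_irrefl by (auto simp: triangle_block_def nN_iff)
  qed
  have nsub: "(\<exists>p. E a p \<and> p \<in> N \<and> p \<notin> {a, b, c}) \<or> nN a \<subseteq> {b, c}" for a b c
    using E_irrefl by (auto simp: nN_iff)
  consider "nN a \<subseteq> {b, c}" "nN b \<subseteq> {a, c}" | "nN b \<subseteq> {c, a}" "nN c \<subseteq> {b, a}"
    | "nN c \<subseteq> {a, b}" "nN a \<subseteq> {c, b}"
    using nsub[of a b c] nsub[of b c a] nsub[of c a b] two[of a _ b _ c] two[of b _ c _ a] two[of c _ a _ b] t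
    by (smt (verit) insert_commute)
  then show ?thesis
  proof cases
    case 1 then show ?thesis using one[of a b c] t YN by blast
  next
    case 2 then show ?thesis using one[of b c a] t YN by (metis insert_commute)
  next
    case 3 then show ?thesis using one[of c a b] t YN by (metis insert_commute)
  qed
qed

lemma edge_in_tree_block:
  assumes no4: "\<And>a b c d C. quad_block a b c d C \<Longrightarrow> \<not> C \<subseteq> Y"
    and no3: "\<And>a b c. \<lbrakk>a \<in> Y; b \<in> Y; c \<in> Y; E a b; E b c; E c a\<rbrakk> \<Longrightarrow> False"
    and Y: "N_closed Y" "v \<in> Y" "nN v \<noteq> {}"
  shows "\<exists>a b C. tree_block a b C \<and> C \<subseteq> Y"
proof -
  have nY: "z \<in> Y" if "a \<in> Y" "E a z" "z \<in> N" for a z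
    using Y(1) that unfolding N_closed_def nN_def by blast
  have YN: "a \<in> Y \<Longrightarrow> a \<in> N" for a using Y(1) by (auto simp: N_closed_def)
  have disj: "nN a \<inter> nN b = {}" if "a \<in> Y" "b \<in> Y" "E a b" for a b
    using no3 nY that E_sym unfolding nN_def by blast
  \<comment> \<open>The first vertex of a path \<open>p\<close>, \<open>a\<close>, \<open>b\<close>,
    \<open>q\<close> is a leaf: another neighbour would give a triangle, a 4-cycle or a path on five
    vertices.\<close>
  have leaf: "nN p = {a}" if "p \<in> Y" "a \<in> Y" "b \<in> Y" "q \<in> Y" "E p a" "E a b" "E b q" "p \<noteq> b" "a \<noteq> q"
    for p a b q
  proof -
    have pq: "p \<noteq> q" using no3[of a b p] that E_sym by blast
    have "y = a" if "y \<in> nN p" for y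
    proof (rule ccontr)
      assume "y \<noteq> a"
      have y: "y \<in> N" "E p y" using that by (auto simp: nN_iff)
      have "y \<in> Y" using nY \<open>p \<in> Y\<close> y by blast
      have "y \<noteq> b" using no3[of a b p] y \<open>E p a\<close> \<open>E a b\<close> \<open>p \<in> Y\<close> \<open>a \<in> Y\<close> \<open>b \<in> Y\<close> E_sym by blast
      moreover have "y \<noteq> q"
        using no4[of p a b q "{p, a, b, q}"] y \<open>E p a\<close> \<open>E a b\<close> \<open>E b q\<close> \<open>p \<noteq> b\<close> \<open>a \<noteq> q\<close> pq
          \<open>p \<in> Y\<close> \<open>a \<in> Y\<close> \<open>b \<in> Y\<close> \<open>q \<in> Y\<close> YN E_sym E_neq
        by (auto simp: quad_block_def)
      ultimately show False
        using no_path_N[of y p a b q] y \<open>E p a\<close> \<open>E a b\<close> \<open>E b q\<close> \<open>p \<noteq> b\<close> \<open>a \<noteq> q\<close> pq \<open>y \<noteq> a\<close>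
          \<open>p \<in> Y\<close> \<open>a \<in> Y\<close> \<open>b \<in> Y\<close> \<open>q \<in> Y\<close> YN E_sym E_neq
        by auto
    qed
    then show ?thesis using that YN unfolding nN_def by blast
  qed
  have sub: "nN a \<union> nN b \<subseteq> Y" if "a \<in> Y" "b \<in> Y" for a b
    using Y(1) that by (auto simp: N_closed_def)
  show ?thesis
  \<comment> \<open>If a path on four vertices exists, its inner vertices serve as the two centres.
    Otherwise the component of \<open>v\<close> is a star.\<close>
  proof (cases "\<exists>p a b q. p \<in> Y \<and> a \<in> Y \<and> b \<in> Y \<and> q \<in> Y \<and> E p a \<and> E a b \<and> E b q \<and> p \<noteq> b \<and> a \<noteq> q")
    case True
    then obtain p a b q where P: "p \<in> Y" "a \<in> Y" "b \<in> Y" "q \<in> Y" "E p a" "E a b" "E b q" "p \<noteq> b" "a \<noteq> q"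
      by blast
    have 1: "nN z = {a}" if "z \<in> nN a - {b}" for z
    proof -
      have "z \<in> Y" "E z a" "z \<noteq> b" using that nY P E_sym unfolding nN_def by blast+
      then show ?thesis using leaf[of z a b q] P YN by blast
    qed
    have 2: "nN z = {b}" if "z \<in> nN b - {a}" for z
    proof -
      have "z \<in> Y" "E z b" "z \<noteq> a" using that nY P E_sym unfolding nN_def by blast+
      then show ?thesis using leaf[of z b a p] P YN E_sym by blast
    qed
    have "tree_block a b (nN a \<union> nN b)"
      using 1 2 disj[of a b] P YN unfolding tree_block_def by blast
    then show ?thesis using sub[of a b] P by blast
  next
    case False
    obtain y where y: "y \<in> N" "E v y" "y \<in> Y" using Y unfolding N_closed_def nN_def by blast
    have star: "tree_block a b (nN a \<union> nN b)" if ab: "a \<in> Y" "b \<in> Y" "E a b" "nN b = {a}" for a b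
    proof -
      have "nN z = {a}" if z: "z \<in> nN a - {b}" for z
      proof -
        have "z \<in> Y" using z ab(1) nY by (auto simp: nN_iff)
        have "t = a" if "t \<in> nN z" for t
        proof (rule ccontr)
          assume "t \<noteq> a"
          have "t \<in> Y" using that nY \<open>z \<in> Y\<close> by (auto simp: nN_iff)
          then show False using False ab z that \<open>z \<in> Y\<close> \<open>t \<noteq> a\<close> E_sym
            by (metis (no_types, lifting) DiffD1 DiffD2 insertI1 nN_iff)
        qed
        then show ?thesis using z ab YN E_sym unfolding nN_def by blast
      qed
      then show ?thesis using disj[of a b] ab YN unfolding tree_block_def by blast
    qed
    show ?thesis
    \<comment> \<open>Either \<open>v\<close> is a leaf and \<open>y\<close> the centre, or
      \<open>v\<close> has a second neighbour and is itself the centre, with \<open>y\<close> a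
      leaf.\<close>
    proof (cases "nN v = {y}")
      case True
      then show ?thesis using star[of y v] y Y sub[of y v] E_sym by blast
    next
      case ne: False
      then obtain z where z: "z \<in> N" "E v z" "z \<noteq> y" using Y y unfolding nN_def by blast
      then have "z \<in> Y" using nY Y by blast
      have "t = v" if "t \<in> nN y" for t
        using False nY[of y t] y that z \<open>z \<in> Y\<close> Y(2) E_sym by (metis nN_iff)
      then have "nN y = {v}" using y Y YN E_sym unfolding nN_def by blast
      then show ?thesis using star[of v y] y Y sub[of v y] by blast
    qed
  qed
qed

text \<open>Allows components to be split off one at a time, without a formal decomposition into
  components.\<close>

lemma edge_in_block:
  assumes "N_closed Y" "v \<in> Y" "nN v \<noteq> {}"
  shows "(\<exists>a b c d C. quad_block a b c d C \<and> C \<subseteq> Y) \<or> (\<exists>a b c C. triangle_block a b c C \<and> C \<subseteq> Y) \<or>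
    (\<exists>a b C. tree_block a b C \<and> C \<subseteq> Y)"
proof (rule ccontr)
  assume *: "\<not> ?thesis"
  have no3: False if t: "a \<in> Y" "b \<in> Y" "c \<in> Y" "E a b" "E b c" "E c a" for a b c
  proof -
    obtain a' b' c' where eq: "{a', b', c'} = {a, b, c}" and tb: "triangle_block a' b' c' (insert c' (nN c'))"
      using triangle_in_block[OF _ assms(1) t] * by blast
    have "c' \<in> {a, b, c}" unfolding eq[symmetric] by simp
    then have "c' \<in> Y" using t by auto
    then have "insert c' (nN c') \<subseteq> Y" using assms(1) by (simp add: N_closed_def)
    then show False using * tb by blast
  qed
  have "\<exists>a b C. tree_block a b C \<and> C \<subseteq> Y"
    by (rule edge_in_tree_block[of Y v]) (use * no3 assms in blast)+
  then show False using * by blast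
qed

subsection \<open>The gain of each component\<close>

text \<open>A vertex of \<open>W\<close> attached to the block has all its neighbours in
  \<open>N\<close> inside it, so \<open>pen_ge\<close> applies. With \<open>s\<close> and
  \<open>P\<close> the sums of \<open>x\<close> and \<open>pen\<close>, adding up subinvariance
  gives \<open>9 * s <= 4 + 3 * s + 2 * P\<close>, while the gain is at most
  \<open>2 * s - 4 - P\<close>.\<close>

lemma gain_quad_block:
  assumes q: "quad_block a b c d C"
  shows "(\<Sum>v\<in>C. gain v) \<le> - 3 / 2"
proof -
  have C: "C = {a, b, c, d}" "distinct [a, b, c, d]" "C \<subseteq> N" "E a b" "E b c" "E c d" "E d a"
    using q by (auto simp: quad_block_def)
  have cl: "N_closed C" using quad_block_closed[OF q] .
  have cC: "card C = 4" "finite C" using C by auto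
  have sub4: "nN w \<subseteq> {a, b, c, d}" if "E w a" "w \<in> W" "distinct [a, b, c, d]" "{a, b, c, d} \<subseteq> N"
    "E a b" "E b c" "E c d" "E d a" for a b c d w
  proof
    fix z assume z: "z \<in> nN w"
    show "z \<in> {a, b, c, d}"
      using no_path[of c b z a w] that z E_sym V_split by (auto simp: nN_iff)
  qed
  have dw: "dN w \<le> 4" if "v \<in> C" "w \<in> nW v" for v w
  proof -
    have "w \<in> W" "E w v" using that E_sym by (auto simp: nW_def)
    moreover have "v = a \<or> v = b \<or> v = c \<or> v = d" using that C by auto
    ultimately have "nN w \<subseteq> {a, b, c, d}"
      using sub4[of w a b c d] sub4[of w b c d a] sub4[of w c d a b] sub4[of w d a b c] C by auto
    then have "nN w \<subseteq> C" using C by auto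
    then show ?thesis using card_mono[OF cC(2)] cC by (fastforce simp: dN_def)
  qed
  define s where "s = (\<Sum>v\<in>C. x v)"
  define P where "P = (\<Sum>v\<in>C. pen v)"
  have nsub: "nN v \<subseteq> C - {v}" if "v \<in> C" for v
    using cl that E_irrefl by (auto simp: N_closed_def nN_iff)
  have "r * x v \<le> 1 + (s - x v) + 2 * pen v" if "v \<in> C" for v
  proof -
    have "(\<Sum>w\<in>nN v. x w) \<le> (\<Sum>w\<in>C - {v}. x w)"
      using nsub[OF that] cC x_nonneg by (intro sum_mono2) auto
    also have "\<dots> = s - x v" using that cC by (simp add: s_def sum_diff1)
    finally show ?thesis using subinvariant_N[of v] pen_ge[of v] dw[OF that] that C(3) by fastforce
  qed
  then have "(\<Sum>v\<in>C. r * x v) \<le> (\<Sum>v\<in>C. 1 + (s - x v) + 2 * pen v)" by (rule sum_mono)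
  then have "r * s \<le> 4 + 3 * s + 2 * P"
    using cC by (simp add: sum.distrib sum_subtractf s_def P_def flip: sum_distrib_left)
  moreover have s0: "s \<ge> 0" "P \<ge> 0" by (simp_all add: s_def P_def x_nonneg pen_nonneg sum_nonneg)
  moreover have "9 * s \<le> r * s" using r_ge_9 s0 by (intro mult_right_mono) auto
  moreover have "gain v \<le> 2 * x v - 1 - pen v" if "v \<in> C" for v
  proof -
    have "card (nN v) \<le> card (C - {v})" using nsub[OF that] cC by (intro card_mono) auto
    then have "dN v \<le> 3" using that cC by (simp add: dN_def)
    moreover have "dN v \<ge> 2"
    proof -
      have "\<exists>y z. y \<noteq> z \<and> {y, z} \<subseteq> nN v"
        using that C E_sym by (auto simp: nN_iff)
      then obtain y z where "y \<noteq> z" "{y, z} \<subseteq> nN v" by blast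
      then show ?thesis using card_mono[of "nN v" "{y, z}"] by (simp add: dN_def)
    qed
    \<comment> \<open>Every corner has two or three neighbours in the block: 3 bounds the positive
      term of the gain and 2 the negative one.\<close>
    ultimately have "(dN v - 1) * x v \<le> 2 * x v" "dN v \<ge> 2"
      using x_nonneg[of v] by (auto intro: mult_right_mono)
    then show ?thesis by (simp add: gain_def)
  qed
  then have "(\<Sum>v\<in>C. gain v) \<le> (\<Sum>v\<in>C. 2 * x v - 1 - pen v)" by (rule sum_mono)
  then have "(\<Sum>v\<in>C. gain v) \<le> 2 * s - 4 - P"
    using cC by (simp add: sum_subtractf s_def P_def sum_distrib_left)
  ultimately show ?thesis by linarith
qed

lemma gain_leaf: "nN v = {a} \<Longrightarrow> gain v \<le> - 1 / 2"
  using pen_nonneg[of v] by (simp add: gain_def dN_def)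

text \<open>The pendant vertices cancel the gain of \<open>c\<close>, leaving
  \<open>x a + x b - 2\<close> minus the penalties of \<open>a\<close> and \<open>b\<close>.
  Subinvariance at \<open>a\<close> and \<open>b\<close> bounds \<open>x a + x b\<close> by 1/2 plus
  a quarter of these penalties.\<close>

lemma gain_triangle_block:
  assumes q: "triangle_block a b c C"
  shows "(\<Sum>v\<in>C. gain v) \<le> - 3 / 2"
proof -
  have C: "C = insert c (nN c)" "c \<in> N" "nN a = {b, c}" "nN b = {a, c}" "a \<in> nN c" "b \<in> nN c"
    and lf: "\<And>z. z \<in> nN c - {a, b} \<Longrightarrow> nN z = {c}"
    using q unfolding triangle_block_def by blast+
  have E: "E a b" "E b c" "E a c" "a \<in> N" "b \<in> N" "c \<in> N"
    using C E_sym unfolding nN_def by blast+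
  have ne: "a \<noteq> b" "b \<noteq> c" "a \<noteq> c" using E E_neq by auto
  define L where "L = nN c - {a, b}"
  have CL: "C = insert a (insert b (insert c L))" "a \<notin> L" "b \<notin> L" "c \<notin> L" "finite L"
    using C(1,5,6) ne E_irrefl by (auto simp: L_def nN_iff)
  have dc: "dN c = card L + 2"
  proof -
    have "nN c = insert a (insert b L)" using C(5,6) by (auto simp: L_def)
    then show ?thesis using CL ne by (simp add: dN_def)
  qed
  have "gain v \<le> - 1 / 2" if "v \<in> L" for v
    using gain_leaf lf that unfolding L_def by blast
  then have gL: "(\<Sum>v\<in>L. gain v) \<le> - card L / 2"
    using sum_bounded_above[of L gain "- 1 / 2"] by simp
  have gc: "gain c \<le> card L / 2"
  proof -
    have "(dN c - 1) * x c \<le> dN c - 1" using dc x_le_1[of c] mult_left_mono[of "x c" 1 "dN c - 1"] by simp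
    then show ?thesis using pen_nonneg[of c] dc unfolding gain_def by linarith
  qed
  have dab: "dN a = 2" "dN b = 2" using C ne by (auto simp: dN_def)
  have sub3: "dN w \<le> 4" if "w \<in> nW a" "a \<in> N" "b \<in> N" "c \<in> N" "E a b" "E b c" "E a c" for a b c w
  proof -
    have "nN w \<subseteq> {a, b, c}"
    proof
      fix z assume z: "z \<in> nN w"
      show "z \<in> {a, b, c}"
        using no_path[of b c z a w] that z E_sym V_split E_neq by (auto simp: nN_iff nW_def)
    qed
    then have "card (nN w) \<le> card {a, b, c}" by (intro card_mono) auto
    also have "\<dots> \<le> 3" by (simp add: card_insert_if)
    finally show ?thesis by (simp add: dN_def)
  qed
  have "r * x a \<le> 1 + (x b + x c) + 2 * pen a"
    using subinvariant_N[of a] pen_ge[of a] sub3[of _ a b c] E ne(2) C(3) by simp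
  moreover have "r * x b \<le> 1 + (x a + x c) + 2 * pen b"
    using subinvariant_N[of b] pen_ge[of b] sub3[of _ b a c] E E_sym[OF E(1)] ne(3) C(4) by simp
  moreover have "9 * x a \<le> r * x a" "9 * x b \<le> r * x b"
    using r_ge_9 x_nonneg by (auto intro: mult_right_mono)
  moreover have "gain a = x a - 1 - pen a" "gain b = x b - 1 - pen b"
    using dab by (auto simp: gain_def)
  moreover have "(\<Sum>v\<in>C. gain v) = gain a + gain b + gain c + (\<Sum>v\<in>L. gain v)"
    using CL ne by simp
  ultimately show ?thesis using gL gc x_le_1[of c] x_nonneg[of a] x_nonneg[of b] pen_nonneg[of a] pen_nonneg[of b]
    by linarith
qed

text \<open>At a leaf the coefficient \<open>dN z - 1\<close> of \<open>x z\<close> vanishes, so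
  only the centres keep an entry of \<open>x\<close>; \<open>dN a + dN b - 1\<close> is the number
  of edges of the tree.\<close>

lemma gain_tree_block:
  assumes q: "tree_block a b C"
  shows "(\<Sum>v\<in>C. gain v) = (dN a - 1) * x a + (dN b - 1) * x b - (dN a + dN b - 1) - (\<Sum>v\<in>C. pen v)"
proof -
  have C: "C = nN a \<union> nN b" "a \<in> N" "b \<in> N" "E a b" "nN a \<inter> nN b = {}"
    and lf: "\<And>z. z \<in> nN a - {b} \<Longrightarrow> nN z = {a}" "\<And>z. z \<in> nN b - {a} \<Longrightarrow> nN z = {b}"
    using q unfolding tree_block_def by blast+
  have in': "b \<in> nN a" "a \<in> nN b" using C E_sym by (auto simp: nN_iff)
  have lf': "(dN z - 1) * x z - dN z / 2 = - 1 / 2" if "z \<in> nN a - {b} \<or> z \<in> nN b - {a}" for z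
    using that lf[of z] by (auto simp: dN_def)
  define h where "h z = (dN z - 1) * x z - dN z / 2" for z
  have "(\<Sum>v\<in>C. gain v) = (\<Sum>v\<in>C. h v) - (\<Sum>v\<in>C. pen v)"
    by (simp add: gain_def h_def sum_subtractf)
  also have "(\<Sum>v\<in>C. h v) = (\<Sum>v\<in>nN a. h v) + (\<Sum>v\<in>nN b. h v)"
    using C by (simp add: sum.union_disjoint)
  also have "(\<Sum>v\<in>nN a. h v) = h b + (\<Sum>v\<in>nN a - {b}. h v)"
    using in' by (simp add: sum.remove)
  also have "(\<Sum>v\<in>nN a - {b}. h v) = (\<Sum>v\<in>nN a - {b}. - 1 / 2)"
    using lf' by (intro sum.cong) (auto simp: h_def)
  also have "(\<Sum>v\<in>nN b. h v) = h a + (\<Sum>v\<in>nN b - {a}. h v)"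
    using in' by (simp add: sum.remove)
  also have "(\<Sum>v\<in>nN b - {a}. h v) = (\<Sum>v\<in>nN b - {a}. - 1 / 2)"
    using lf' by (intro sum.cong) (auto simp: h_def)
  finally have 1: "(\<Sum>v\<in>C. gain v) = h a + h b - card (nN a - {b}) / 2 - card (nN b - {a}) / 2 - (\<Sum>v\<in>C. pen v)"
    by simp
  have "real (card (nN a - {b})) = dN a - 1" "real (card (nN b - {a})) = dN b - 1"
    using in' card_Suc_Diff1[of "nN a" b] card_Suc_Diff1[of "nN b" a] by (auto simp: dN_def)
  then show ?thesis using 1 unfolding h_def by argo
qed

lemma dN_ge_1: "z \<in> nN v \<Longrightarrow> dN v \<ge> 1"
  using card_gt_0_iff[of "nN v"] by (auto simp: dN_def)

lemma gain_tree_block_le: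
  assumes q: "tree_block a b C"
  shows "(\<Sum>v\<in>C. gain v) \<le> - 1 - (\<Sum>v\<in>C. pen v)" "(\<Sum>v\<in>C. gain v) \<le> - 1"
proof -
  have "b \<in> nN a" "a \<in> nN b" using q E_sym unfolding tree_block_def nN_iff by blast+
  then have "dN a \<ge> 1" "dN b \<ge> 1" using dN_ge_1 by auto
  then have "(dN a - 1) * x a \<le> dN a - 1" "(dN b - 1) * x b \<le> dN b - 1"
    using x_le_1 by (auto intro: mult_left_le)
  then show *: "(\<Sum>v\<in>C. gain v) \<le> - 1 - (\<Sum>v\<in>C. pen v)"
    unfolding gain_tree_block[OF q] by linarith
  show "(\<Sum>v\<in>C. gain v) \<le> - 1"
    using * sum_nonneg[of C pen] pen_nonneg by fastforce
qed

lemma gain_isolated: "nN v = {} \<Longrightarrow> gain v = - x v - pen v"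
  by (simp add: gain_def dN_def)

text \<open>Blocks have negative gain and are removed one by one; once no edge is left, every vertex
  has gain at most 0.\<close>

lemma gain_closed_le_0:
  assumes "N_closed Y"
  shows "(\<Sum>v\<in>Y. gain v) \<le> 0"
  using assms
proof (induction "card Y" arbitrary: Y rule: less_induct)
  case less
  have fin: "finite Y" using less.prems finite_subset[of Y N] by (simp add: N_closed_def)
  have step: ?case if "C \<subseteq> Y" "N_closed C" "C \<noteq> {}" "(\<Sum>v\<in>C. gain v) \<le> 0" for C
  proof -
    have "card (Y - C) < card Y" using that fin by (intro psubset_card_mono) auto
    then have "(\<Sum>v\<in>Y - C. gain v) \<le> 0" using less N_closed_Diff that(2) by blast
    moreover have "(\<Sum>v\<in>Y. gain v) = (\<Sum>v\<in>Y - C. gain v) + (\<Sum>v\<in>C. gain v)"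
      using that fin by (simp add: sum.subset_diff)
    ultimately show ?thesis using that by simp
  qed
  show ?case
  proof (cases "\<exists>a b c d C. quad_block a b c d C \<and> C \<subseteq> Y")
    case True
    then obtain a b c d C where C: "quad_block a b c d C" "C \<subseteq> Y" by blast
    then have "C \<noteq> {}" by (auto simp: quad_block_def)
    then show ?thesis using step[of C] C quad_block_closed gain_quad_block[OF C(1)] by fastforce
  next
    case no4: False
    show ?thesis
    proof (cases "\<exists>a b c C. triangle_block a b c C \<and> C \<subseteq> Y")
      case True
      then obtain a b c C where C: "triangle_block a b c C" "C \<subseteq> Y" by blast
      have "C \<noteq> {}" using C(1) unfolding triangle_block_def by blast
      then show ?thesis using step[of C] C triangle_block_closed gain_triangle_block[OF C(1)] by fastforce
    next
      case no3: False
      show ?thesis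
      proof (cases "\<exists>a b C. tree_block a b C \<and> C \<subseteq> Y")
        case True
        then obtain a b C where C: "tree_block a b C" "C \<subseteq> Y" by blast
        have "C \<noteq> {}" using C(1) unfolding tree_block_def nN_def by blast
        then show ?thesis using step[of C] C tree_block_closed gain_tree_block_le[OF C(1)] by fastforce
      next
        case no2: False
        have "nN v = {}" if "v \<in> Y" for v
          using edge_in_block[OF less.prems that] no4 no3 no2 by blast
        then have "gain v \<le> 0" if "v \<in> Y" for v
          using that gain_isolated[of v] x_nonneg[of v] pen_nonneg[of v] by simp
        then show ?thesis by (rule sum_nonpos)
      qed
    qed
  qed
qed

subsection \<open>The extremal structure\<close>

lemma N_closed_N: "N_closed N" by (simp add: N_closed_def nN_sub)

lemma sum_gain_split: "C \<subseteq> N \<Longrightarrow> (\<Sum>v\<in>N. gain v) = (\<Sum>v\<in>C. gain v) + (\<Sum>v\<in>N - C. gain v)"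
  using sum.subset_diff[of C N gain] by simp

lemma sum_gain_gt: "(\<Sum>v\<in>N. gain v) > - 3 / 2"
  using main_inequality sum_nonneg[of "{w \<in> W. dN w = 0}" dW] by simp

lemma gain_closed_gt:
  assumes "N_closed C" shows "(\<Sum>v\<in>C. gain v) > - 3 / 2"
  using sum_gain_gt sum_gain_split[of C] assms gain_closed_le_0[OF N_closed_Diff[OF N_closed_N assms]]
  by (simp add: N_closed_def)

text \<open>The complement of a closed set has gain at most 0, so no closed set can use up the whole
  budget \<open>- 3 / 2\<close>. This rules out the other two kinds of block.\<close>

lemma edge_in_closed:
  assumes "N_closed Y" "v \<in> Y" "nN v \<noteq> {}"
  obtains a b C where "tree_block a b C" "C \<subseteq> Y"
  using edge_in_block[OF assms] gain_closed_gt quad_block_closed triangle_block_closed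
    gain_quad_block gain_triangle_block by (metis linorder_not_less)

text \<open>With no edge inside \<open>N\<close> the total gain would be at most \<open>- r\<close>,
  and with two tree blocks at most \<open>- 2\<close>; both are below
  \<open>- 3 / 2\<close>.\<close>

lemma single_tree_block:
  obtains a b C where "tree_block a b C" "\<forall>v\<in>N - C. nN v = {}"
proof -
  have "\<exists>v\<in>N. nN v \<noteq> {}"
  proof (rule ccontr)
    assume "\<not> (\<exists>v\<in>N. nN v \<noteq> {})"
    then have "gain v \<le> - x v" if "v \<in> N" for v
      using gain_isolated[of v] pen_nonneg[of v] that by auto
    then have "(\<Sum>v\<in>N. gain v) \<le> (\<Sum>v\<in>N. - x v)" by (rule sum_mono)
    then show False using sum_gain_gt subinvariant_u r_ge_9 by (simp add: sum_negf)
  qed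
  then obtain a b C where C: "tree_block a b C" "C \<subseteq> N" using edge_in_closed[OF N_closed_N] by blast
  have cl: "N_closed C" "N_closed (N - C)" using C tree_block_closed N_closed_N N_closed_Diff by auto
  have "nN v = {}" if v: "v \<in> N - C" for v
  proof (rule ccontr)
    assume "nN v \<noteq> {}"
    then obtain a' b' C' where C': "tree_block a' b' C'" "C' \<subseteq> N - C"
      using edge_in_closed[OF cl(2) v] by blast
    have fin: "finite (N - C)" by simp
    have "(\<Sum>v\<in>N - C. gain v) = (\<Sum>v\<in>C'. gain v) + (\<Sum>v\<in>N - C - C'. gain v)"
      using sum.subset_diff[OF C'(2) fin, of gain] by simp
    moreover have "(\<Sum>v\<in>N - C - C'. gain v) \<le> 0"
      using gain_closed_le_0 N_closed_Diff cl C' tree_block_closed by blast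
    ultimately show False
      using sum_gain_split[OF C(2)] sum_gain_gt gain_tree_block_le(2)[OF C(1)] gain_tree_block_le(2)[OF C'(1)]
      by linarith
  qed
  then show ?thesis using that C(1) by blast
qed

lemma sum_pen: "(\<Sum>v\<in>N. pen v) = (\<Sum>w\<in>W. dN w * cost w)"
  unfolding pen_def by (rule sum_N_nW)

section \<open>Consequences of a single star or double star in the neighbourhood\<close>

context
  fixes a b C
  assumes tb: "tree_block a b C" and iso: "\<forall>v\<in>N - C. nN v = {}"
begin

lemma block_subset: "C \<subseteq> N" using tree_block_closed[OF tb] by (simp add: N_closed_def)

lemma tree_block_centres:
  "a \<in> N" "b \<in> N" "E a b" "b \<in> nN a" "a \<in> nN b" "a \<noteq> b" "C = nN a \<union> nN b" "nN a \<inter> nN b = {}"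
  using tb E_sym E_neq unfolding tree_block_def nN_def by blast+

lemma tree_block_leaves: "z \<in> nN a - {b} \<Longrightarrow> nN z = {a}" "z \<in> nN b - {a} \<Longrightarrow> nN z = {b}"
  using tb unfolding tree_block_def by blast+

lemma dN_centres: "dN a \<ge> 1" "dN b \<ge> 1" using tree_block_centres dN_ge_1 by auto

text \<open>The tree itself costs 1 of the available 3/2. The remaining losses, all nonnegative,
  must fit into the slack 1/2.\<close>

lemma tree_inequality:
  "(dN a - 1) * (1 - x a) + (dN b - 1) * (1 - x b) + (\<Sum>w\<in>W. dN w * cost w)
    + (\<Sum>w | w \<in> W \<and> dN w = 0. dW w) / 2 + (\<Sum>v\<in>N - C. x v) < 1 / 2"
proof -
  have "(\<Sum>v\<in>N - C. gain v) = (\<Sum>v\<in>N - C. - x v - pen v)"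
    using gain_isolated iso by (intro sum.cong) auto
  then have "(\<Sum>v\<in>N. gain v) = (dN a - 1) * x a + (dN b - 1) * x b - (dN a + dN b - 1)
      - (\<Sum>v\<in>C. pen v) - (\<Sum>v\<in>N - C. x v) - (\<Sum>v\<in>N - C. pen v)"
    using sum_gain_split[OF block_subset] gain_tree_block[OF tb] by (simp add: sum_subtractf sum_negf)
  moreover have "(\<Sum>v\<in>C. pen v) + (\<Sum>v\<in>N - C. pen v) = (\<Sum>w\<in>W. dN w * cost w)"
    using sum.subset_diff[OF block_subset, of pen] sum_pen by simp
  ultimately show ?thesis using main_inequality by (simp add: algebra_simps)
qed

lemma tree_terms_nonneg: "0 \<le> (dN a - 1) * (1 - x a)" "0 \<le> (dN b - 1) * (1 - x b)"
  "0 \<le> (\<Sum>w\<in>W. dN w * cost w)" "0 \<le> (\<Sum>w | w \<in> W \<and> dN w = 0. dW w)" "0 \<le> (\<Sum>v\<in>N - C. x v)"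
  using dN_centres x_le_1 x_nonneg cost_nonneg by (auto intro!: mult_nonneg_nonneg sum_nonneg)

lemma small_isolated: "(\<Sum>v\<in>N - C. x v) < 1 / 2"
  using tree_inequality tree_terms_nonneg by linarith

lemma W_cost:
  assumes "w \<in> W" "dN w > 0"
  shows "dN w * (1 - x w) + dW w / 2 < 1 / 2"
proof -
  have "dN w * cost w \<le> (\<Sum>w\<in>W. dN w * cost w)"
    using assms cost_nonneg by (intro member_le_sum) auto
  moreover have "dN w * cost w = dN w * (1 - x w) + dW w / 2"
    using assms by (simp add: cost_def field_simps)
  ultimately show ?thesis using tree_inequality tree_terms_nonneg by linarith
qed

lemma W_nW_empty:
  assumes "w \<in> W" "dN w > 0"
  shows "nW w = {}"
proof -
  have "0 \<le> dN w * (1 - x w)" using x_le_1[of w] by simp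
  then have "dW w < 1" using W_cost[OF assms] by linarith
  then show ?thesis by (simp add: dW_def card_eq_0_iff)
qed

text \<open>One to three neighbours in \<open>N\<close> make \<open>x w\<close> too small for
  \<open>W_cost\<close>. With four or more, \<open>w\<close> cannot be adjacent to a leaf, by
  \<open>no_path\<close>; its neighbours are then centres or isolated in \<open>N\<close> and have
  total weight at most 5/2, so \<open>x w\<close> is again too small.\<close>

lemma W_dN_zero:
  assumes w: "w \<in> W"
  shows "dN w = 0"
proof (rule ccontr)
  assume "dN w \<noteq> 0"
  then have pos: "dN w > 0" using dN_nonneg[of w] by linarith
  have sub: "r * x w \<le> (\<Sum>v\<in>nN w. x v)" using subinvariant_W[OF w] W_nW_empty[OF w pos] by simp
  have c: "dN w * (1 - x w) < 1 / 2" using W_cost[OF w pos] dW_nonneg[of w] by linarith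
  have nine: "9 * x w \<le> r * x w" using r_ge_9 x_nonneg by (intro mult_right_mono) auto
  have "card (nN w) = 1 \<or> card (nN w) = 2 \<or> card (nN w) = 3 \<or> card (nN w) \<ge> 4"
    using pos unfolding dN_def by arith
  then have int: "dN w = 1 \<or> dN w = 2 \<or> dN w = 3 \<or> dN w \<ge> 4" by (auto simp: dN_def)
  have "9 * x w \<le> dN w" using sub sum_x_le_card[of "nN w"] nine by (simp add: dN_def)
  with int c have d4: "dN w \<ge> 4" by (elim disjE) (auto simp: algebra_simps)
  have leaf: False if "c \<in> nN w" "c \<in> nN a" "c \<noteq> b" "a \<in> N" "b \<in> N" "E a b" for a b c
  proof -
    have "\<not> nN w \<subseteq> {a, b, c}"
    proof
      assume "nN w \<subseteq> {a, b, c}"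
      then have "card (nN w) \<le> card {a, b, c}" by (intro card_mono) auto
      also have "\<dots> \<le> 3" by (simp add: card_insert_if)
      finally show False using d4 by (simp add: dN_def)
    qed
    then obtain p where p: "p \<in> N" "E w p" "p \<notin> {a, b, c}" unfolding nN_def by blast
    have "distinct [u, b, a, c, w, p]" using that p w V_split E_neq[OF \<open>E a b\<close>] E_neq[of a c]
      by (auto simp: nN_iff)
    moreover have "E b a" "E a c" "E c w" using that E_sym unfolding nN_def by blast+
    ultimately show False using no_path[of b a p c w] that p by blast
  qed
  have "nN w \<subseteq> {a, b} \<union> (N - C)"
    using leaf[of _ a b] leaf[of _ b a] tree_block_centres nN_sub E_sym by blast
  then have "(\<Sum>v\<in>nN w. x v) \<le> (\<Sum>v\<in>{a, b} \<union> (N - C). x v)"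
    using x_nonneg by (intro sum_mono2) auto
  also have "\<dots> = (\<Sum>v\<in>{a, b}. x v) + (\<Sum>v\<in>N - C. x v)"
    using tree_block_centres(4,5,7) by (intro sum.union_disjoint) auto
  also have "(\<Sum>v\<in>{a, b}. x v) \<le> 2" using tree_block_centres(6) x_le_1[of a] x_le_1[of b] by simp
  finally have "x w \<le> 1 / 2" using small_isolated sub nine by linarith
  then have "dN w * (1 - x w) \<ge> 4 * (1 / 2)" using d4 by (intro mult_mono) auto
  then show False using c by linarith
qed

text \<open>A vertex of \<open>W\<close> has a neighbour, which must lie in \<open>W\<close> too;
  the two ends of this edge alone contribute at least 1 to \<open>tree_inequality\<close>.\<close>

lemma W_empty: "W = {}"
proof (rule ccontr)
  assume "W \<noteq> {}"
  then obtain w where w: "w \<in> W" by blast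
  obtain z where z: "E w z" using no_isolated[OF W_V[OF w]] by blast
  have "nN w = {}" using W_dN_zero[OF w] by (simp add: dN_def)
  then have "z \<notin> N" using z by (auto simp: nN_iff)
  moreover have "z \<noteq> u" using W_E[OF w] z by auto
  moreover have "z \<in> V" using E_V E_sym z by blast
  ultimately have zW: "z \<in> W" using V_split(1) by blast
  have "z \<in> nW w" "w \<in> nW z" using z zW w E_sym unfolding nW_def by blast+
  then have d: "dW w \<ge> 1" "dW z \<ge> 1" using card_gt_0_iff[of "nW w"] card_gt_0_iff[of "nW z"]
    by (auto simp: dW_def)
  have "(\<Sum>v\<in>{w, z}. dW v) \<le> (\<Sum>w | w \<in> W \<and> dN w = 0. dW w)"
    using w zW W_dN_zero by (intro sum_mono2) auto
  moreover have "w \<noteq> z" using z E_neq by blast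
  ultimately show False using d tree_inequality tree_terms_nonneg by simp
qed

lemma nW_empty: "nW v = {}" using W_empty by (auto simp: nW_def)

lemma subinvariant_N': "v \<in> N \<Longrightarrow> r * x v \<le> 1 + (\<Sum>w\<in>nN v. x w)"
  using subinvariant_N[of v] nW_empty by simp

text \<open>There are \<open>card N\<close> edges at \<open>u\<close> and \<open>card C - 1\<close>
  in the tree, where \<open>card C = dN a + dN b\<close>.\<close>

lemma edge_count_tree: "real m = 2 * (dN a + dN b) - 1 + card (N - C)"
proof -
  have fin: "finite C" by (rule finite_subset[OF block_subset finite_N])
  have one: "dN v = 1" if "v \<in> nN a - {b} \<or> v \<in> nN b - {a}" for v
  proof -
    have "nN v = {a} \<or> nN v = {b}" using that tree_block_leaves by blast
    then show ?thesis by (auto simp: dN_def)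
  qed
  have cC: "real (card C) = dN a + dN b"
    using tree_block_centres by (simp add: card_Un_disjoint dN_def)
  have "(\<Sum>v\<in>N. dN v) = (\<Sum>v\<in>C. dN v) + (\<Sum>v\<in>N - C. dN v)"
    using sum.subset_diff[OF block_subset, of dN] by simp
  also have "(\<Sum>v\<in>N - C. dN v) = 0" using iso by (intro sum.neutral) (auto simp: dN_def)
  also have "(\<Sum>v\<in>C. dN v) = (\<Sum>v\<in>nN a. dN v) + (\<Sum>v\<in>nN b. dN v)"
    using tree_block_centres by (simp add: sum.union_disjoint)
  also have "(\<Sum>v\<in>nN a. dN v) = dN b + (\<Sum>v\<in>nN a - {b}. dN v)"
    using tree_block_centres by (simp add: sum.remove)
  also have "(\<Sum>v\<in>nN a - {b}. dN v) = (\<Sum>v\<in>nN a - {b}. 1)"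
    by (intro sum.cong refl one) blast
  also have "(\<Sum>v\<in>nN b. dN v) = dN a + (\<Sum>v\<in>nN b - {a}. dN v)"
    using tree_block_centres by (simp add: sum.remove)
  also have "(\<Sum>v\<in>nN b - {a}. dN v) = (\<Sum>v\<in>nN b - {a}. 1)"
    by (intro sum.cong refl one) blast
  finally have "(\<Sum>v\<in>N. dN v) = dN a + dN b + card (nN a - {b}) + card (nN b - {a})" by simp
  moreover have "real (card (nN a - {b})) = dN a - 1" "real (card (nN b - {a})) = dN b - 1"
    using tree_block_centres(4,5) card_Suc_Diff1[of "nN a" b] card_Suc_Diff1[of "nN b" a] by (auto simp: dN_def)
  moreover have "card N = card C + card (N - C)"
    using card_Un_disjoint[of C "N - C"] block_subset fin by (simp add: Un_absorb1)
  ultimately show ?thesis using edge_count W_empty cC by simp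
qed

text \<open>With \<alpha> leaves at \<open>a\<close>, the slack keeps \<open>x a\<close> near 1. But
  leaves have entries at most \<open>2 / r\<close>, so expanding twice at \<open>a\<close> bounds
  \<open>r\<^sup>2 * x a\<close> by \<open>2 * r + 2 * \<alpha>\<close>. This is too little, as
  \<open>r\<^sup>2\<close> exceeds \<open>r + 4 * \<alpha>\<close>.\<close>

lemma no_double_star:
  assumes "dN a \<ge> 2" "dN a \<le> dN b"
  shows False
proof -
  define \<alpha> where "\<alpha> = dN a - 1"
  have al: "\<alpha> \<ge> 1" using assms by (simp add: \<alpha>_def)
  have 1: "\<alpha> * (1 - x a) < 1 / 2" using tree_inequality tree_terms_nonneg unfolding \<alpha>_def by linarith
  have "r * x v \<le> 2" if "v \<in> nN a - {b}" for v
    using subinvariant_N'[of v] tree_block_leaves(1)[OF that] that x_le_1[of a] by (auto simp: nN_iff)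
  then have "(\<Sum>v\<in>nN a - {b}. r * x v) \<le> real (card (nN a - {b})) * 2"
    by (rule sum_bounded_above)
  moreover have "real (card (nN a - {b})) = \<alpha>"
    using tree_block_centres(4) card_Suc_Diff1[of "nN a" b] by (auto simp: dN_def \<alpha>_def)
  ultimately have "r * (\<Sum>v\<in>nN a - {b}. x v) \<le> 2 * \<alpha>" by (simp add: sum_distrib_left)
  moreover have "r * x a \<le> 1 + x b + (\<Sum>v\<in>nN a - {b}. x v)"
    using subinvariant_N'[OF tree_block_centres(1)] tree_block_centres(4) by (simp add: sum.remove)
  then have "r * (r * x a) \<le> r * (1 + x b + (\<Sum>v\<in>nN a - {b}. x v))"
    using r_ge_9 by (intro mult_left_mono) auto
  moreover have "r * (1 + x b) \<le> r * 2" using x_le_1[of b] r_ge_9 by (intro mult_left_mono) auto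
  ultimately have 2: "r\<^sup>2 * x a \<le> 2 * r + 2 * \<alpha>" by (simp add: power2_eq_square algebra_simps)
  have 3: "r\<^sup>2 > r + 4 * \<alpha>" using r_large edge_count_tree assms(2) by (simp add: \<alpha>_def)
  have "\<alpha> * (r\<^sup>2 * x a) \<le> \<alpha> * (2 * r + 2 * \<alpha>)" using 2 al by (intro mult_left_mono) auto
  moreover have "r\<^sup>2 * (\<alpha> * (1 - x a)) \<le> r\<^sup>2 * (1 / 2)" using 1 by (intro mult_left_mono) auto
  ultimately have 4: "r\<^sup>2 * (\<alpha> - 1 / 2) \<le> \<alpha> * (2 * r + 2 * \<alpha>)" by (simp add: algebra_simps)
  have r9: "r\<^sup>2 \<ge> 9 * r" using r_ge_9 by (simp add: power2_eq_square)
  \<comment> \<open>A bootstrap: the estimate \<open>\<alpha> - 1 / 2 >= \<alpha> / 2\<close> yields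
    \<open>\<alpha> >= 2\<close>, and then the factor improves from 1/2 to 3/4, which
    suffices.\<close>
  have "\<alpha> * (r\<^sup>2 / 2) \<le> r\<^sup>2 * (\<alpha> - 1 / 2)"
    using mult_right_mono[of 1 \<alpha> "r\<^sup>2 / 2"] al by (simp add: algebra_simps)
  then have "\<alpha> * (r\<^sup>2 / 2) \<le> \<alpha> * (2 * r + 2 * \<alpha>)" using 4 by linarith
  then have "r\<^sup>2 / 2 \<le> 2 * r + 2 * \<alpha>" using al by simp
  then have "\<alpha> \<ge> 2" using r9 r_ge_9 by linarith
  then have "\<alpha> * (3 * r\<^sup>2 / 4) \<le> r\<^sup>2 * (\<alpha> - 1 / 2)"
    using mult_right_mono[of 2 \<alpha> "r\<^sup>2 / 4"] by (simp add: algebra_simps)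
  then have "\<alpha> * (3 * r\<^sup>2 / 4) \<le> \<alpha> * (2 * r + 2 * \<alpha>)" using 4 by linarith
  then have "3 * r\<^sup>2 / 4 \<le> 2 * r + 2 * \<alpha>" using al by simp
  then show False using 3 r9 r_ge_9 by linarith
qed

text \<open>Put \<open>e = 1 - x a\<close> and \<open>R = r + d\<close>. Expanding twice at
  \<open>u\<close> gives \<open>R * e < 1 / 2\<close>, hence \<open>e\<close> is tiny. Expanding
  twice at \<open>a\<close> gives \<open>(k - 1 / 2) * (1 - e) <= R * e\<close>, which is impossible
  for \<open>k >= 2\<close>.\<close>

lemma star_isolated:
  assumes b: "dN b = 1"
  shows "card (N - C) < 2"
proof (rule ccontr)
  assume "\<not> card (N - C) < 2"
  define k where "k = real (card (N - C))"
  have k: "k \<ge> 2" using \<open>\<not> card (N - C) < 2\<close> by (simp add: k_def)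
  define d where "d = dN a"
  have d1: "d \<ge> 1" using dN_centres by (simp add: d_def)
  define S where "S = (\<Sum>v\<in>nN a. x v)"
  have nb: "nN b = {a}" using b tree_block_centres(5) by (auto simp: dN_def card_1_singleton_iff)
  have "r * x v \<le> 1 + x a" if "v \<in> nN a" for v
    using subinvariant_N'[of v] tree_block_leaves(1)[of v] nb that by (cases "v = b") (auto simp: nN_iff)
  then have "(\<Sum>v\<in>nN a. r * x v) \<le> real (card (nN a)) * (1 + x a)" by (rule sum_bounded_above)
  then have 1: "r * S \<le> d * (1 + x a)" by (simp add: S_def d_def dN_def sum_distrib_left)
  have "r * x v \<le> 1" if "v \<in> N - C" for v
    using subinvariant_N'[of v] bspec[OF iso that] that by simp
  then have "(\<Sum>v\<in>N - C. r * x v) \<le> real (card (N - C)) * 1" by (rule sum_bounded_above)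
  then have 2: "r * (\<Sum>v\<in>N - C. x v) \<le> k" by (simp add: k_def sum_distrib_left)
  have "r \<le> (\<Sum>v\<in>C. x v) + (\<Sum>v\<in>N - C. x v)"
    using subinvariant_u sum.subset_diff[OF block_subset, of x] by simp
  moreover have "(\<Sum>v\<in>C. x v) = S + x a"
    using tree_block_centres nb by (simp add: S_def)
  ultimately have "r * r \<le> r * (S + x a + (\<Sum>v\<in>N - C. x v))"
    using r_ge_9 by (intro mult_left_mono) auto
  then have 3: "r\<^sup>2 \<le> r * x a + d * (1 + x a) + k" using 1 2 by (simp add: power2_eq_square algebra_simps)
  have "r * (r * x a) \<le> r * (1 + S)"
    using subinvariant_N'[OF tree_block_centres(1)] r_ge_9 by (intro mult_left_mono) (auto simp: S_def)
  then have 4: "r\<^sup>2 * x a \<le> r + d * (1 + x a)" using 1 by (simp add: power2_eq_square algebra_simps)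
  have 5: "r\<^sup>2 > r + 2 * d + k - 1 / 2" using r_large edge_count_tree b by (simp add: d_def k_def)
  define R where "R = r + d"
  define e where "e = 1 - x a"
  have e: "0 \<le> e" "e \<le> 1" using x_nonneg x_le_1 by (auto simp: e_def)
  have "R * e < 1 / 2" using 3 5 by (simp add: R_def e_def algebra_simps)
  moreover have "10 * e \<le> R * e" using r_ge_9 d1 e by (intro mult_right_mono) (auto simp: R_def)
  moreover have "(r + 2 * d + k - 1 / 2) * x a \<le> r\<^sup>2 * x a"
    using 5 x_nonneg by (intro mult_right_mono) auto
  then have "(k - 1 / 2) * (1 - e) \<le> R * e" using 4 by (simp add: R_def e_def algebra_simps)
  then have "(3 / 2) * (1 - e) \<le> R * e"
    using mult_right_mono[of "3 / 2" "k - 1 / 2" "1 - e"] k e by (auto intro: order_trans)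
  ultimately show False by argo
qed

end

text \<open>The smaller centre has degree 1 inside \<open>N\<close>, so the block is a star with
  centre \<open>a\<close> and leaves \<open>L\<close>. Then
  \<open>m = 2 * card L + 1 + card (N - C)\<close>, and parity leaves exactly one vertex
  \<open>p\<close> isolated in \<open>N\<close>.\<close>

lemma extremal_structure:
  assumes "even m"
  obtains a p L where "distinct [u, a, p]" "u \<notin> L" "a \<notin> L" "p \<notin> L" "V = {u, a, p} \<union> L"
    "m = 2 * card L + 2"
    "\<And>v. v \<in> V \<Longrightarrow> E u v \<longleftrightarrow> v \<noteq> u"
    "\<And>v. v \<in> V \<Longrightarrow> E a v \<longleftrightarrow> v = u \<or> v \<in> L"
    "\<And>v. v \<in> V \<Longrightarrow> E p v \<longleftrightarrow> v = u"
    "\<And>v w. v \<in> V \<Longrightarrow> w \<in> L \<Longrightarrow> E w v \<longleftrightarrow> v = u \<or> v = a"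
proof -
  obtain a0 b0 C where tb0: "tree_block a0 b0 C" and iso: "\<forall>v\<in>N - C. nN v = {}"
    using single_tree_block by blast
  have "\<exists>a b. tree_block a b C \<and> dN b \<le> dN a"
  proof (cases "dN b0 \<le> dN a0")
    case False
    have "tree_block b0 a0 C" using tb0 E_sym unfolding tree_block_def by blast
    then show ?thesis using False by (meson linorder_le_cases)
  qed (use tb0 in blast)
  then obtain a b where tb: "tree_block a b C" and le: "dN b \<le> dN a" by blast
  have tb': "tree_block b a C" using tb E_sym unfolding tree_block_def by blast
  note centres = tree_block_centres[OF tb iso]
  have "dN b < 2" using no_double_star[OF tb' iso] le by fastforce
  then have b1: "dN b = 1" using dN_centres(2)[OF tb iso] by (simp add: dN_def)
  then have nb: "nN b = {a}" using centres(5) by (auto simp: dN_def card_1_singleton_iff)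
  define L where "L = nN a"
  have C: "C = insert a L" using centres(7) nb by (auto simp: L_def)
  have "real m = real (2 * card L + 1 + card (N - C))"
    using edge_count_tree[OF tb iso] b1 by (simp add: L_def dN_def)
  then have m: "m = 2 * card L + 1 + card (N - C)" by linarith
  then have "odd (card (N - C))" using assms by simp
  then have "card (N - C) = 1" using star_isolated[OF tb iso b1]
    by (metis even_zero less_2_cases One_nat_def)
  then obtain p where p: "N - C = {p}" by (auto simp: card_1_singleton_iff)
  have N: "N = insert p (insert a L)" "p \<notin> C" "p \<in> N" using p C block_subset[OF tb iso] by auto
  have V: "V = {u, a, p} \<union> L" using V_split(1) W_empty[OF tb iso] N by auto
  have np: "nN p = {}" using iso p by blast
  have nl: "nN w = {a}" if "w \<in> L" for w
    using tree_block_leaves(1)[OF tb iso, of w] nb that unfolding L_def by blast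
  have aL: "a \<notin> L" using E_irrefl by (auto simp: L_def nN_iff)
  have uN: "u \<notin> N" by (rule V_split)
  have EV: "E w v \<longleftrightarrow> v = u \<or> v \<in> nN w" if "w \<in> N" "v \<in> V" for v w
  proof -
    have "V = insert u N" using V_split(1) W_empty[OF tb iso] by simp
    then show ?thesis using that N_E(2)[OF that(1)] unfolding nN_def by blast
  qed
  show ?thesis
  proof (rule that)
    show "distinct [u, a, p]" "u \<notin> L" "a \<notin> L" "p \<notin> L" using uN N C aL by auto
    show "V = {u, a, p} \<union> L" by (rule V)
    show "m = 2 * card L + 2" using m \<open>card (N - C) = 1\<close> by simp
    show "E u v \<longleftrightarrow> v \<noteq> u" if "v \<in> V" for v
      using that V_split(1) W_empty[OF tb iso] N_E(1) E_irrefl by blast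
    show "E a v \<longleftrightarrow> v = u \<or> v \<in> L" if "v \<in> V" for v using EV[of a v] that N by (simp add: L_def)
    show "E p v \<longleftrightarrow> v = u" if "v \<in> V" for v using EV[of p v] that N np by simp
    show "E w v \<longleftrightarrow> v = u \<or> v = a" if "v \<in> V" "w \<in> L" for v w using EV[of w v] that N nl by simp
  qed
qed

end

section \<open>The theorem\<close>

lemma S_minus_iso:
  assumes d: "distinct [u, a, p]" "u \<notin> L" "a \<notin> L" "p \<notin> L" and V: "verts G = {u, a, p} \<union> L"
    and n: "n \<ge> 4" and L: "finite L" "card L = n - 3"
    and u: "\<And>v. v \<in> verts G \<Longrightarrow> {u, v} \<in> edges G \<longleftrightarrow> v \<noteq> u"
    and a: "\<And>v. v \<in> verts G \<Longrightarrow> {a, v} \<in> edges G \<longleftrightarrow> v = u \<or> v \<in> L"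
    and p: "\<And>v. v \<in> verts G \<Longrightarrow> {p, v} \<in> edges G \<longleftrightarrow> v = u"
    and l: "\<And>v w. v \<in> verts G \<Longrightarrow> w \<in> L \<Longrightarrow> {w, v} \<in> edges G \<longleftrightarrow> v = u \<or> v = a"
  shows "G \<cong>\<^sub>g S_minus n 2"
proof -
  have "card L = card {2..<n - 1}" using L n by simp
  then obtain h where h: "bij_betw h L {2..<n - 1}"
    using finite_same_card_bij[OF L(1), of "{2..<n - 1}"] by auto
  \<comment> \<open>The deleted edge of \<open>S_minus n 2\<close> joins 0 and \<open>n - 1\<close>.
    These must be the images of \<open>a\<close> and the pendant vertex \<open>p\<close>, so
    \<open>u\<close> goes to 1.\<close>
  define f where "f v = (if v = u then 1 else if v = a then 0 else if v = p then n - 1 else h v)" for v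
  have hL: "2 \<le> h v" "h v < n - 1" if "v \<in> L" for v using h that by (auto simp: bij_betw_def)
  have f: "f u = 1" "f a = 0" "f p = n - 1" using d by (auto simp: f_def)
  have fL: "f v = h v" if "v \<in> L" for v using that d by (auto simp: f_def)
  have "bij_betw f L {2..<n - 1}" using h fL by (simp add: bij_betw_cong[of L f h])
  moreover have "bij_betw f {u, a, p} {1, 0, n - 1}"
    using f d n by (auto simp: bij_betw_def inj_on_def)
  moreover have "{1, 0, n - 1} \<inter> {2..<n - 1} = {}" using n by auto
  ultimately have "bij_betw f ({u, a, p} \<union> L) ({1, 0, n - 1} \<union> {2..<n - 1})"
    by (intro bij_betw_combine)
  moreover have "{1, 0, n - 1} \<union> {2..<n - 1} = {..<n}" using n by auto
  ultimately have bij: "bij_betw f (verts G) (verts (S_minus n 2))" by (simp add: V S_minus_verts)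
  have "{v, w} \<in> edges G \<longleftrightarrow> {f v, f w} \<in> edges (S_minus n 2)" if vw: "v \<in> verts G" "w \<in> verts G" for v w
  proof -
    have e: "{f v, f w} \<in> edges (S_minus n 2) \<longleftrightarrow> f v \<noteq> f w \<and> (f v < 2 \<or> f w < 2) \<and>
      \<not> (f v = 0 \<and> f w = n - 1) \<and> \<not> (f w = 0 \<and> f v = n - 1)"
      using S_minus_edge[OF n, of "f v" "f w"] vw bij by (auto simp: bij_betw_def S_minus_verts)
    have w: "w = u \<and> f w = 1 \<or> w = a \<and> f w = 0 \<or> w = p \<and> f w = n - 1 \<or> w \<in> L \<and> 2 \<le> f w \<and> f w < n - 1"
      using vw(2) V f fL hL by auto
    have v: "v = u \<and> f v = 1 \<or> v = a \<and> f v = 0 \<or> v = p \<and> f v = n - 1 \<or> v \<in> L \<and> 2 \<le> f v \<and> f v < n - 1"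
      using vw(1) V f fL hL by auto
    have ne: "u \<noteq> a" "u \<noteq> p" "a \<noteq> p" "u \<notin> L" "a \<notin> L" "p \<notin> L" using d by auto
    have G: "{v, w} \<in> edges G \<longleftrightarrow> v = u \<and> w \<noteq> u \<or> v = a \<and> (w = u \<or> w \<in> L) \<or> v = p \<and> w = u
      \<or> v \<in> L \<and> (w = u \<or> w = a)"
      using v u[OF vw(2)] a[OF vw(2)] p[OF vw(2)] l[OF vw(2)] ne by metis
    show ?thesis
      unfolding e G using v
      by (elim disjE conjE; use w in \<open>elim disjE conjE\<close>; use ne n in force)
  qed
  then show ?thesis unfolding graph_iso_def using bij by blast
qed

lemma large_spectral_radius_imp_S_minus:
  assumes m: "m \<ge> 74" "even m" and G: "simple_graph G" "graph_free (cycle_plus 5) G"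
    "card (edges G) = m" "\<not> (\<exists>v. isolated_vertex G v)"
    and large: "\<rho> (S_minus ((m + 4) div 2) 2) \<le> \<rho> G"
  shows "G \<cong>\<^sub>g S_minus ((m + 4) div 2) 2"
proof -
  define n where "n = (m + 4) div 2"
  have n: "n \<ge> 4" "m = 2 * n - 4" using m by (auto simp: n_def)
  have r: "(\<rho> G)\<^sup>2 - \<rho> G > real m - 3 / 2"
    using S_minus_spectral_radius_bound(1)[OF n(1), of "\<rho> G"] large n by (simp add: n_def[symmetric] of_nat_diff)
  have V: "verts G \<noteq> {}"
  proof
    assume "verts G = {}"
    then have "edges G = {}" using G(1) by (auto simp: simple_graph_def)
    then show False using G(3) m by simp
  qed
  obtain x u where x: "\<And>v. 0 \<le> x v" "\<And>v. x v \<le> 1" "u \<in> verts G" "x u = 1"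
    "\<And>v. v \<in> verts G \<Longrightarrow> \<rho> G * x v \<le> (\<Sum>w | w \<in> verts G \<and> {v, w} \<in> edges G. x w)"
    by (rule ex_subinvariant_vector[OF G(1) V]) blast
  have r1: "\<rho> G > 1"
    using S_minus_spectral_radius_bound(2)[OF n(1)] large by (simp add: n_def)
  \<comment> \<open>This is where \<open>m >= 74\<close> enters: \<open>m - 3 / 2\<close> exceeds
    72, the value of \<open>t * (t - 1)\<close> at 9.\<close>
  have "\<rho> G \<ge> 9"
  proof (rule ccontr)
    assume "\<not> \<rho> G \<ge> 9"
    then have "\<rho> G * (\<rho> G - 1) \<le> 9 * 8" using r1 by (intro mult_mono) auto
    then show False using r m by (simp add: power2_eq_square algebra_simps)
  qed
  interpret C5_plus_free_subeigenvector "verts G" "\<lambda>v w. {v, w} \<in> edges G" x "\<rho> G" m u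
  proof
    show "finite (verts G)" using G(1) by (simp add: simple_graph_def)
    show "{w, v} \<in> edges G" if "{v, w} \<in> edges G" for v w using that by (simp add: insert_commute)
    show "{v, v} \<notin> edges G" for v using simple_graph_edge[OF G(1)] by blast
    show "v \<in> verts G" if "{v, w} \<in> edges G" for v w using simple_graph_edge[OF G(1) that] by blast
    show False if "{v0, v1} \<in> edges G" "{v1, v2} \<in> edges G" "{v2, v3} \<in> edges G" "{v3, v4} \<in> edges G"
      "{v4, v0} \<in> edges G" "{v0, w} \<in> edges G" "{v1, w} \<in> edges G" "distinct [v0, v1, v2, v3, v4, w]"
      for v0 v1 v2 v3 v4 w
      using C5_plus_not_free[OF G(1) that] G(2) by blast
    show "(\<Sum>v\<in>verts G. card {w \<in> verts G. {v, w} \<in> edges G}) = 2 * m"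
      using sum_vertex_degree[OF G(1)] G(3) by (simp add: vertex_degree_eq[OF G(1)])
    show "\<exists>w. {v, w} \<in> edges G" if "v \<in> verts G" for v
    proof (rule ccontr)
      assume "\<not> (\<exists>w. {v, w} \<in> edges G)"
      then have "isolated_vertex G v" using that by (simp add: isolated_vertex_def vertex_degree_eq[OF G(1)])
      then show False using G(4) by blast
    qed
  qed (use x r \<open>\<rho> G \<ge> 9\<close> in auto)
  obtain a p L where s: "distinct [u, a, p]" "u \<notin> L" "a \<notin> L" "p \<notin> L" "verts G = {u, a, p} \<union> L"
    and mL: "m = 2 * card L + 2"
    and e: "\<And>v. v \<in> verts G \<Longrightarrow> {u, v} \<in> edges G \<longleftrightarrow> v \<noteq> u"
    "\<And>v. v \<in> verts G \<Longrightarrow> {a, v} \<in> edges G \<longleftrightarrow> v = u \<or> v \<in> L"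
    "\<And>v. v \<in> verts G \<Longrightarrow> {p, v} \<in> edges G \<longleftrightarrow> v = u"
    "\<And>v w. v \<in> verts G \<Longrightarrow> w \<in> L \<Longrightarrow> {w, v} \<in> edges G \<longleftrightarrow> v = u \<or> v = a"
    by (rule extremal_structure[OF m(2)]) blast
  have "finite L" using finite_V s(5) by simp
  moreover have "card L = n - 3" using mL n by simp
  ultimately show ?thesis
    unfolding n_def[symmetric] using s e n(1) by (intro S_minus_iso[of u a p L]) blast+
qed

theorem theorem1p6:
  fixes G :: "'a graph" and m :: nat
  assumes "m \<ge> 74" and "even m"
    and "simple_graph G"
    and "graph_free (cycle_plus 5) G"
    and "card (edges G) = m"
    and "\<not> (\<exists>v. isolated_vertex G v)"
  shows "\<rho> G \<le> \<rho> (S_minus ((m + 4) div 2) 2) \<and>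
    (\<rho> G = \<rho> (S_minus ((m + 4) div 2) 2) \<longleftrightarrow> G \<cong>\<^sub>g S_minus ((m + 4) div 2) 2)"
proof -
  have "\<rho> G = \<rho> (S_minus ((m + 4) div 2) 2)" if "G \<cong>\<^sub>g S_minus ((m + 4) div 2) 2"
    using graph_iso_spectral_radius[OF that assms(3)] .
  \<comment> \<open>A graph reaching the extremal radius is isomorphic to the extremal graph, so
    strict excess would contradict the equality just shown.\<close>
  moreover have "G \<cong>\<^sub>g S_minus ((m + 4) div 2) 2" if "\<rho> (S_minus ((m + 4) div 2) 2) \<le> \<rho> G"
    using large_spectral_radius_imp_S_minus[OF assms that] .
  ultimately show ?thesis by linarith
qed

end
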